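(* Let $X,Y$ be Hilbert spaces, $A:X\to Y$ a bounded linear operator, $C\subset X$ a closed convex set, and $y\in Y$ such that $Ax=y$ has a solution in $C$. Let $x^\dagger$ be the unique solution of $\min\{\frac12\|x\|^2: x\in C,\ Ax=y\}$. For $\delta>0$ and $y^\delta\in Y$ with $\|y^\delta-y\|\le\delta$, consider the dual projected Landweber iteration with $\lambda_0=0$: $$x_n=P_C(A^*\lambda_n),\qquad \lambda_{n+1}=\lambda_n-\gamma(Ax_n-y^\delta),\qquad n\ge0.$$ (i) If $0<\gamma\le1/\|A\|^2$, then for integers $n_\delta$ satisfying $n_\delta\to\infty$ and $\delta^2n_\delta\to0$ as $\delta\to0$ there holds $\|x_{n_\delta}-x^\dagger\|\to0$ as $\delta\to0$. If in addition $x^\dagger$ satisfies the projected source condition $$x^\dagger=P_C\big((A^*A)^{\nu/2}\omega\big)\quad\text{for some }0<\nu\le1\text{ and }\omega\in X,$$ then with the choice $n_\delta\sim\delta^{-\frac{2}{1+\nu}}$ one has $\|x_{n_\delta}-x^\dagger\|=O(\delta^{\frac{\nu}{1+\nu}})$. (ii) If $\tau>1$ and $\gamma>0$ are chosen such that $1-1/\tau-\|A\|^2\gamma>0$, then the discrepancy principle $$\|Ax_{n_\delta}-y^\delta\|\le\tau\delta<\|Ax_n-y^\delta\|,\qquad 0\le n<n_\delta,$$ defines a finite integer $n_\delta$, and $\|x_{n_\delta}-x^\dagger\|\to0$ as $\delta\to0$. If in addition $x^\dagger$ satisfies the projected source condition $x^\dagger=P_C((A^*A)^{\nu/2}\omega)$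 for some $0<\nu\le1$ and $\omega\in X$, then $\|x_{n_\delta}-x^\dagger\|=O(\delta^{\frac{\nu}{1+\nu}})$.
   Context: All spaces are real; norms are all written $\|\cdot\|$. $A^*:Y\to X$ is the Hilbert space adjoint, $(A^*A)^{\nu/2}$ is the fractional power of the bounded nonnegative self-adjoint operator $A^*A$, and $P_C$ is the metric projection of $X$ onto $C$. The iterates depend on $y^\delta$ (and hence on $\delta$). $n_\delta\sim\delta^{-s}$ means that $n_\delta$ is an integer lying between two fixed positive multiples of $\delta^{-s}$; $O(\cdot)$ is understood as $\delta\to0$, with constants independent of $\delta$ and of the particular $y^\delta$. *)

theory Defs
  imports "HOL-Analysis.Analysis"
begin

text \<open>The library constant \<open>closest_point\<close> is restricted to Heine-Borel, i.e. finite-dimensional,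
  spaces. The description below denotes whenever the set is nonempty, closed and convex in a
  Hilbert space.\<close>

definition metric_proj :: "'a::real_inner set \<Rightarrow> 'a \<Rightarrow> 'a" where
  "metric_proj C x = (THE z. z \<in> C \<and> (\<forall>w\<in>C. dist x z \<le> dist x w))"

definition poly_op :: "real poly \<Rightarrow> ('a::real_normed_vector \<Rightarrow> 'a) \<Rightarrow> 'a \<Rightarrow> 'a" where
  "poly_op p T x = (\<Sum>i\<le>degree p. coeff p i *\<^sub>R (T ^^ i) x)"

text \<open>The fractional power \<open>T\<^sup>s\<close> (\<open>s > 0\<close>) of a bounded nonnegative self-adjoint operator \<open>T\<close> on a
  Hilbert space, by continuous functional calculus: the spectrum of \<open>T\<close> lies in \<open>[0, \<parallel>T\<parallel>]\<close>, and
  \<open>T\<^sup>s\<close> is the operator-norm limit of \<open>p\<^sub>k(T)\<close> for every sequence of polynomials \<open>p\<^sub>k\<close> converging to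
  \<open>t\<^sup>s\<close> uniformly on that interval. The limit exists and does not depend on the sequence because
  \<open>\<parallel>p(T)\<parallel> \<le> sup {\<bar>p t\<bar> | 0 \<le> t \<le> \<parallel>T\<parallel>}\<close>; such sequences exist by Weierstrass' theorem, as
  \<open>0 powr s = 0\<close> makes \<open>t powr s\<close> continuous at 0.\<close>

definition frac_power :: "('a::real_inner \<Rightarrow> 'a) \<Rightarrow> real \<Rightarrow> 'a \<Rightarrow> 'a" where
  "frac_power T s = (THE B. bounded_linear B \<and>
     (\<forall>p :: nat \<Rightarrow> real poly.
        uniform_limit {0..onorm T} (\<lambda>k t. poly (p k) t) (\<lambda>t. t powr s) sequentially \<longrightarrow>
        (\<lambda>k. onorm (\<lambda>x. poly_op (p k) T x - B x)) \<longlonglongrightarrow> 0))"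

definition min_norm_solution :: "('a::real_inner \<Rightarrow> 'b::real_inner) \<Rightarrow> 'a set \<Rightarrow> 'b \<Rightarrow> 'a" where
  "min_norm_solution A C y =
     (THE x. is_arg_min (\<lambda>x. 1/2 * (norm x)\<^sup>2) (\<lambda>x. x \<in> C \<and> A x = y) x)"

text \<open>The sequences \<open>\<lambda>\<^sub>n\<close> and \<open>x\<^sub>n\<close>; the argument \<open>yd\<close> is the noisy datum.\<close>

primrec landweber_dual ::
  "('a::real_inner \<Rightarrow> 'b::real_inner) \<Rightarrow> 'a set \<Rightarrow> real \<Rightarrow> 'b \<Rightarrow> nat \<Rightarrow> 'b" where
  "landweber_dual A C \<gamma> yd 0 = 0"
| "landweber_dual A C \<gamma> yd (Suc n) =
     landweber_dual A C \<gamma> yd n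
       - \<gamma> *\<^sub>R (A (metric_proj C (adjoint A (landweber_dual A C \<gamma> yd n))) - yd)"

definition landweber_iter ::
  "('a::real_inner \<Rightarrow> 'b::real_inner) \<Rightarrow> 'a set \<Rightarrow> real \<Rightarrow> 'b \<Rightarrow> nat \<Rightarrow> 'a" where
  "landweber_iter A C \<gamma> yd n = metric_proj C (adjoint A (landweber_dual A C \<gamma> yd n))"

definition discrepancy_index ::
  "('a::real_inner \<Rightarrow> 'b::real_inner) \<Rightarrow> 'a set \<Rightarrow> real \<Rightarrow> real \<Rightarrow> real \<Rightarrow> 'b \<Rightarrow> nat \<Rightarrow> bool" where
  "discrepancy_index A C \<gamma> \<tau> \<delta> yd N \<longleftrightarrow>
     norm (A (landweber_iter A C \<gamma> yd N) - yd) \<le> \<tau> * \<delta> \<and>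
     (\<forall>n<N. \<tau> * \<delta> < norm (A (landweber_iter A C \<gamma> yd n) - yd))"

definition projected_source ::
  "('a::real_inner \<Rightarrow> 'b::real_inner) \<Rightarrow> 'a set \<Rightarrow> real \<Rightarrow> 'a \<Rightarrow> 'a \<Rightarrow> bool" where
  "projected_source A C \<nu> \<omega> x \<longleftrightarrow> x = metric_proj C (frac_power (adjoint A \<circ> A) (\<nu> / 2) \<omega>)"

end

theory Submission
  imports Defs
begin

text \<open>Write \<open>x l = P\<^sub>C(A\<^sup>*l)\<close> and \<open>x\<^sup>\<dagger>\<close> for the solution of least norm. The iteration is gradient descent
  for the dual functional \<open>l \<mapsto> R\<^sup>*(A\<^sup>*l) - l \<bullet> z\<close> with datum \<open>z\<close>, where \<open>R\<^sup>*\<close> is the convex conjugate of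
  \<open>\<parallel>x\<parallel>\<^sup>2 / 2\<close> restricted to \<open>C\<close>: this functional is convex, its gradient at \<open>l\<close> is \<open>A (x l) - z\<close>, and it is smooth
  with constant \<open>\<parallel>A\<parallel>\<^sup>2\<close>. For exact data, adding \<open>\<parallel>x\<^sup>\<dagger>\<parallel>\<^sup>2 / 2\<close> gives the duality gap, and the strong
  convexity of \<open>\<parallel>x\<parallel>\<^sup>2 / 2\<close> yields \<open>\<parallel>x l - x\<^sup>\<dagger>\<parallel>\<^sup>2 \<le> 2 gap l\<close> (\<open>error_le_gap\<close>). All claims are therefore
  upper bounds for the gap at the iterates.

  A Lyapunov function for gradient descent, with the noise absorbed by Young's inequality, bounds
  the gap after \<open>n\<close> steps by \<open>gap m + \<parallel>m\<parallel>\<^sup>2 / (2 \<gamma> n) + \<gamma> n \<delta>\<^sup>2 / 2\<close> for every dual element \<open>m\<close>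
  (\<open>gap_landweber_le\<close>). For the discrepancy principle, each step before stopping has a gradient of
  norm more than \<open>\<tau> \<delta>\<close>; the resulting extra decrease bounds \<open>n \<delta>\<^sup>2\<close> and leads to
  \<open>gap \<le> K (gap m + \<delta> \<parallel>m\<parallel>)\<close> at the stopping index, again for every \<open>m\<close> (\<open>gap_discrepancy_le\<close>).

  It remains to choose \<open>m\<close>. Convergence follows from strong duality: the gap can be made
  arbitrarily small (\<open>gap_arbitrarily_small\<close>). For the rates, smoothness of \<open>R\<^sup>*\<close> gives
  \<open>gap m \<le> \<parallel>A\<^sup>*m - (A\<^sup>*A)\<^bsup>\<nu>/2\<^esup> \<omega>\<parallel>\<^sup>2 / 2\<close> under the source condition, and a Tikhonov-type choice of \<open>m\<close> makes
  this \<open>O(\<alpha>\<^sup>\<nu>)\<close> with \<open>\<parallel>m\<parallel> = O(\<alpha>\<^bsup>(\<nu>-1)/2\<^esup>)\<close> (\<open>frac_power_approx_in_range\<close>); take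
  \<open>\<alpha> = \<delta>\<^bsup>2/(1+\<nu>)\<^esup>\<close>.

  Fractional powers need only the bound \<open>\<parallel>p(T)\<parallel> \<le> sup {\<bar>p t\<bar> | 0 \<le> t \<le> \<parallel>T\<parallel>}\<close> for polynomials \<open>p\<close> of a
  nonnegative self-adjoint operator \<open>T\<close>. It is derived without spectral theory: a polynomial that is nonnegative on
  \<open>[0, \<parallel>T\<parallel>]\<close> has a nonnegative value at \<open>T\<close>, by induction on the degree, splitting off the factor
  that belongs to a minimum point (\<open>poly_op_nonneg_weighted\<close>).\<close>

section \<open>Metric projections and adjoints in Hilbert spaces\<close>

text \<open>By the parallelogram law two points of a convex set that are almost closest to \<open>x\<close> are
  close to each other, as their midpoint is not closer to \<open>x\<close> than the distance of the set.\<close>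

lemma dist_near_closest_points_le:
  fixes x :: "'a::real_inner"
  assumes "convex C" "u \<in> C" "v \<in> C"
  shows "(dist u v)\<^sup>2 \<le> 2 * (dist x u)\<^sup>2 + 2 * (dist x v)\<^sup>2 - 4 * (infdist x C)\<^sup>2"
proof -
  define m where "m = (1/2) *\<^sub>R u + (1/2) *\<^sub>R v"
  have "m \<in> C"
    using assms unfolding m_def by (intro convexD) auto
  then have "infdist x C \<le> dist x m"
    by (rule infdist_le)
  then have "(infdist x C)\<^sup>2 \<le> (dist x m)\<^sup>2"
    by (simp add: infdist_nonneg)
  moreover have "(dist u v)\<^sup>2 = 2 * (dist x u)\<^sup>2 + 2 * (dist x v)\<^sup>2 - 4 * (dist x m)\<^sup>2"
    unfolding m_def dist_norm power2_norm_eq_inner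
    by (simp add: inner_diff_left inner_diff_right inner_add_left inner_add_right inner_commute)
  ultimately show ?thesis
    by linarith
qed

lemma closest_point_exists_hilbert:
  fixes C :: "'a::{real_inner, complete_space} set"
  assumes "closed C" "convex C" "C \<noteq> {}"
  shows "\<exists>z\<in>C. \<forall>w\<in>C. dist x z \<le> dist x w"
proof -
  define d where "d = infdist x C"
  have "\<exists>w\<in>C. dist x w < d + 1 / real (Suc k)" for k
  proof (rule ccontr)
    assume "\<not> ?thesis"
    then have "d + 1 / real (Suc k) \<le> dist x w" if "w \<in> C" for w
      using that by force
    then have "d + 1 / real (Suc k) \<le> d"
      unfolding d_def infdist_notempty[OF \<open>C \<noteq> {}\<close>] using \<open>C \<noteq> {}\<close> by (intro cINF_greatest) auto
    then show False
      by (simp add: field_simps)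
  qed
  then obtain w where w: "w k \<in> C" "dist x (w k) < d + 1 / real (Suc k)" for k
    by metis
  have "d \<ge> 0"
    by (simp add: d_def infdist_nonneg)
  have d_le: "d \<le> dist x v" if "v \<in> C" for v
    unfolding d_def using that by (rule infdist_le)
  define e where "e k = (d + 1 / real (Suc k))\<^sup>2 - d\<^sup>2" for k
  have le: "(dist (w k) (w j))\<^sup>2 \<le> 2 * e k + 2 * e j" for k j
  proof -
    have "(dist x (w i))\<^sup>2 \<le> d\<^sup>2 + e i" for i
      unfolding e_def using w(2)[of i] by (simp add: power_mono)
    then show ?thesis
      using dist_near_closest_points_le[OF \<open>convex C\<close> w(1)[of k] w(1)[of j], of x]
      unfolding d_def[symmetric] by (smt (verit))
  qed
  have inv0: "(\<lambda>k. 1 / real (Suc k)) \<longlonglongrightarrow> 0"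
    using LIMSEQ_inverse_real_of_nat by (simp add: inverse_eq_divide)
  have "(\<lambda>k. (d + 1 / real (Suc k))\<^sup>2 - d\<^sup>2) \<longlonglongrightarrow> (d + 0)\<^sup>2 - d\<^sup>2"
    by (intro tendsto_diff tendsto_power tendsto_add tendsto_const inv0)
  then have e0: "e \<longlonglongrightarrow> 0"
    unfolding e_def by simp
  have "Cauchy w"
    unfolding Cauchy_def
  proof (intro allI impI)
    fix r :: real assume "r > 0"
    then have "\<forall>\<^sub>F k in sequentially. e k < r\<^sup>2 / 4"
      using order_tendstoD(2)[OF e0, of "r\<^sup>2 / 4"] by simp
    then obtain M where M: "\<And>k. k \<ge> M \<Longrightarrow> e k < r\<^sup>2 / 4"
      unfolding eventually_sequentially by auto
    then have "(dist (w k) (w j))\<^sup>2 < r\<^sup>2" if "k \<ge> M" "j \<ge> M" for k j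
      using le[of k j] M[OF that(1)] M[OF that(2)] by linarith
    then show "\<exists>M. \<forall>k\<ge>M. \<forall>j\<ge>M. dist (w k) (w j) < r"
      using \<open>r > 0\<close> by (meson less_imp_le power_less_imp_less_base)
  qed
  then obtain z where z: "w \<longlonglongrightarrow> z"
    using Cauchy_convergent convergent_def by blast
  have "z \<in> C"
    using closed_sequentially[OF \<open>closed C\<close> _ z] w by blast
  moreover have "dist x z \<le> d"
  proof (rule LIMSEQ_le)
    show "(\<lambda>k. dist x (w k)) \<longlonglongrightarrow> dist x z"
      using z by (intro tendsto_intros)
    show "(\<lambda>k. d + 1 / real (Suc k)) \<longlonglongrightarrow> d"
      using tendsto_add[OF tendsto_const inv0] by simp
  qed (use w in \<open>auto intro: less_imp_le\<close>)
  ultimately show ?thesis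
    using d_le by (meson order_trans)
qed

lemma
  fixes C :: "'a::{real_inner, complete_space} set"
  assumes "closed C" "convex C" "C \<noteq> {}"
  shows metric_proj_in: "metric_proj C x \<in> C"
    and metric_proj_dist_le: "w \<in> C \<Longrightarrow> dist x (metric_proj C x) \<le> dist x w"
    and metric_proj_dot: "w \<in> C \<Longrightarrow> inner (x - metric_proj C x) (w - metric_proj C x) \<le> 0"
proof -
  obtain z where "z \<in> C" "\<forall>w\<in>C. dist x z \<le> dist x w"
    using closest_point_exists_hilbert[OF assms] by blast
  then have "\<exists>!z. z \<in> C \<and> (\<forall>w\<in>C. dist x z \<le> dist x w)"
    using any_closest_point_unique[OF assms(2,1)] by (intro ex1I[of _ z]) auto
  then have *: "metric_proj C x \<in> C \<and> (\<forall>w\<in>C. dist x (metric_proj C x) \<le> dist x w)"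
    unfolding metric_proj_def by (rule theI')
  then show "metric_proj C x \<in> C" and "w \<in> C \<Longrightarrow> dist x (metric_proj C x) \<le> dist x w"
    by auto
  show "w \<in> C \<Longrightarrow> inner (x - metric_proj C x) (w - metric_proj C x) \<le> 0"
    using any_closest_point_dot[OF assms(2,1)] * by blast
qed

lemma metric_proj_eqI:
  fixes C :: "'a::{real_inner, complete_space} set"
  assumes "closed C" "convex C" "z \<in> C" and z: "\<And>w. w \<in> C \<Longrightarrow> inner (x - z) (w - z) \<le> 0"
  shows "metric_proj C x = z"
proof -
  have ne: "C \<noteq> {}"
    using \<open>z \<in> C\<close> by auto
  let ?p = "metric_proj C x"
  have "inner (x - z) (?p - z) \<le> 0" "inner (x - ?p) (z - ?p) \<le> 0"
    using z metric_proj_in[OF assms(1,2) ne] metric_proj_dot[OF assms(1,2) ne] assms(3) by auto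
  then have "inner (?p - z) (?p - z) \<le> 0"
    by (simp add: inner_diff_left inner_diff_right inner_commute)
  then have "inner (?p - z) (?p - z) = 0"
    by (rule order_antisym) simp
  then show ?thesis
    unfolding inner_eq_zero_iff by simp
qed

text \<open>Riesz representation: the point \<open>p\<close> of least norm on the hyperplane \<open>f = 1\<close> is orthogonal
  to the kernel of \<open>f\<close>, so \<open>p / \<parallel>p\<parallel>\<^sup>2\<close> represents \<open>f\<close>.\<close>

lemma riesz_representation:
  fixes f :: "'a::{real_inner, complete_space} \<Rightarrow> real"
  assumes "bounded_linear f"
  shows "\<exists>r. \<forall>x. f x = inner x r"
proof (cases "\<forall>x. f x = 0")
  case True
  then show ?thesis
    by (intro exI[of _ 0]) simp
next
  case False
  interpret f: bounded_linear f by fact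
  define H where "H = {x. f x = 1}"
  obtain u where "f u \<noteq> 0"
    using False by blast
  then have "u /\<^sub>R f u \<in> H"
    by (simp add: H_def f.scale)
  then have ne: "H \<noteq> {}"
    by auto
  have cl: "closed H"
    unfolding H_def by (intro closed_Collect_eq continuous_intros f.continuous_on)
  have cv: "convex H"
    unfolding H_def convex_def by (auto simp: f.add f.scale)
  define p where "p = metric_proj H 0"
  have "p \<in> H" and dot: "\<And>w. w \<in> H \<Longrightarrow> inner (0 - p) (w - p) \<le> 0"
    unfolding p_def using metric_proj_in[OF cl cv ne] metric_proj_dot[OF cl cv ne] by blast+
  have orth: "inner p v = 0" if "f v = 0" for v
    using dot[of "p + v"] dot[of "p - v"] that \<open>p \<in> H\<close> by (simp add: H_def f.add f.diff)
  have "inner x p = f x * inner p p" for x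
    using orth[of "x - f x *\<^sub>R p"] \<open>p \<in> H\<close>
    by (simp add: H_def f.diff f.scale inner_diff_right inner_commute)
  moreover have "inner p p \<noteq> 0"
    using \<open>p \<in> H\<close> f.zero by (auto simp: H_def)
  ultimately have "f x = inner x (p /\<^sub>R inner p p)" for x
    by (metis inner_scaleR_right nonzero_mult_div_cancel_right divide_inverse_commute)
  then show ?thesis
    by blast
qed

lemma adjoint_inner:
  fixes A :: "'a::{real_inner, complete_space} \<Rightarrow> 'b::real_inner"
  assumes "bounded_linear A"
  shows "inner x (adjoint A y) = inner (A x) y"
proof -
  have "\<exists>r. \<forall>x. inner (A x) y = inner x r" for y
    using assms by (intro riesz_representation bounded_linear_inner_left_comp)
  then obtain g where "\<And>x y. inner (A x) y = inner x (g y)"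
    by metis
  then have "adjoint A = g"
    by (intro adjoint_unique) simp
  with \<open>\<And>x y. inner (A x) y = inner x (g y)\<close> show ?thesis
    by simp
qed

lemma adjoint_norm_le:
  fixes A :: "'a::{real_inner, complete_space} \<Rightarrow> 'b::real_inner"
  assumes "bounded_linear A"
  shows "norm (adjoint A y) \<le> onorm A * norm y"
proof (cases "adjoint A y = 0")
  case True
  then show ?thesis
    using onorm_pos_le[OF assms] by simp
next
  case False
  have "(norm (adjoint A y))\<^sup>2 = inner (A (adjoint A y)) y"
    by (simp add: power2_norm_eq_inner adjoint_inner[OF assms])
  also have "\<dots> \<le> norm (A (adjoint A y)) * norm y"
    by (rule norm_cauchy_schwarz)
  also have "\<dots> \<le> onorm A * norm (adjoint A y) * norm y"
    by (intro mult_right_mono onorm[OF assms]) auto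
  finally have "norm (adjoint A y) * norm (adjoint A y) \<le> norm (adjoint A y) * (onorm A * norm y)"
    by (simp add: power2_eq_square mult_ac)
  then show ?thesis
    using False by simp
qed

lemma adjoint_bounded_linear:
  fixes A :: "'a::{real_inner, complete_space} \<Rightarrow> 'b::real_inner"
  assumes "bounded_linear A"
  shows "bounded_linear (adjoint A)"
proof (rule bounded_linear_intro)
  show "norm (adjoint A y) \<le> norm y * onorm A" for y
    using adjoint_norm_le[OF assms] by (simp add: mult.commute)
  show "adjoint A (u + v) = adjoint A u + adjoint A v" for u v
    by (rule vector_eq_ldot[THEN iffD1]) (simp add: adjoint_inner[OF assms] inner_add_right)
  show "adjoint A (r *\<^sub>R u) = r *\<^sub>R adjoint A u" for r u
    by (rule vector_eq_ldot[THEN iffD1]) (simp add: adjoint_inner[OF assms])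
qed

section \<open>Polynomials of a nonnegative self-adjoint operator\<close>

lemma poly_op_pCons:
  assumes "linear T"
  shows "poly_op (pCons a p) T x = a *\<^sub>R x + T (poly_op p T x)"
proof (cases "p = 0")
  case True
  then show ?thesis
    using linear_0[OF assms] by (simp add: poly_op_def)
next
  case False
  then show ?thesis
    by (simp add: poly_op_def sum.atMost_Suc_shift linear_sum[OF assms] linear_scale[OF assms]
        del: sum.atMost_Suc)
qed

lemma poly_op_0 [simp]: "poly_op 0 T x = 0"
  by (simp add: poly_op_def)

lemma poly_op_const [simp]: "poly_op [:c:] T x = c *\<^sub>R x"
  by (simp add: poly_op_def)

lemma poly_op_1 [simp]: "poly_op 1 T x = x"
  by (simp add: poly_op_def)

lemma poly_op_add:
  assumes "linear T"
  shows "poly_op (p + q) T x = poly_op p T x + poly_op q T x"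
  by (induction p q rule: poly_induct2)
    (simp_all add: poly_op_pCons[OF assms] linear_add[OF assms] algebra_simps)

lemma poly_op_smult:
  assumes "linear T"
  shows "poly_op (smult c p) T x = c *\<^sub>R poly_op p T x"
  by (induction p) (simp_all add: poly_op_pCons[OF assms] linear_scale[OF assms] algebra_simps)

lemma poly_op_diff:
  assumes "linear T"
  shows "poly_op (p - q) T x = poly_op p T x - poly_op q T x"
  using poly_op_add[OF assms, of p "smult (-1) q"] poly_op_smult[OF assms, of "-1" q] by simp

lemma poly_op_mult:
  assumes "linear T"
  shows "poly_op (p * q) T x = poly_op p T (poly_op q T x)"
  by (induction p) (simp_all add: poly_op_pCons[OF assms] poly_op_add[OF assms] poly_op_smult[OF assms])

lemma poly_op_linear:
  assumes "linear T"
  shows "linear (poly_op p T)"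
proof (induction p)
  case 0
  show ?case by (simp add: linear_iff)
next
  case (pCons a p)
  then show ?case
    using assms by (simp add: linear_iff poly_op_pCons[OF assms] algebra_simps)
qed

lemma poly_op_commute:
  assumes "linear T"
  shows "poly_op p T (T x) = T (poly_op p T x)"
  by (induction p) (simp_all add: poly_op_pCons[OF assms] linear_add[OF assms]
      linear_scale[OF assms] linear_0[OF assms])

lemma poly_op_self_adjoint:
  assumes "linear T" "\<And>x y. inner (T x) y = inner x (T y)"
  shows "inner (poly_op p T x) y = inner x (poly_op p T y)"
  by (induction p arbitrary: x y) (simp_all add: poly_op_pCons[OF assms(1)] assms(2)
      poly_op_commute[OF assms(1)] inner_add_left inner_add_right)

lemma poly_nonneg_at_removed_point:
  fixes p :: "real poly"
  assumes "a < b" "t0 \<in> {a..b}" and nonneg: "\<And>t. t \<in> {a..b} \<Longrightarrow> t \<noteq> t0 \<Longrightarrow> 0 \<le> poly p t"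
  shows "0 \<le> poly p t0"
proof (rule tendsto_lowerbound)
  show "(poly p \<longlongrightarrow> poly p t0) (at t0 within {a..b})"
    by (intro tendsto_intros)
  show "\<forall>\<^sub>F t in at t0 within {a..b}. 0 \<le> poly p t"
    using nonneg by (auto simp: eventually_at intro!: exI[of _ 1])
  show "at t0 within {a..b} \<noteq> bot"
    using connected_imp_perfect[of "{a..b}" t0] assms(1,2) by (auto simp: trivial_limit_within)
qed

text \<open>A polynomial that is nonnegative on \<open>[0,b]\<close> becomes one of lower degree with the same
  property after subtracting its minimum and dividing by \<open>t\<close>, by \<open>b - t\<close> or by \<open>(t - t0)\<^sup>2\<close>, according
  to whether the minimum is attained at an end point or at an interior point \<open>t0\<close>.\<close>

lemma nonneg_poly_reduction:
  fixes q :: "real poly"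
  assumes "0 < b" and q: "\<And>t. t \<in> {0..b} \<Longrightarrow> 0 \<le> poly q t"
  obtains (const) c where "0 \<le> c" "q = [:c:]"
    | (step) c g h t0 where "0 \<le> c" "q = [:c:] + g * h" "degree h < degree q"
      "g = [:0, 1:] \<or> g = [:b, -1:] \<or> g = [:-t0, 1:] * [:-t0, 1:]"
      "\<And>t. t \<in> {0..b} \<Longrightarrow> 0 \<le> poly h t"
proof -
  have "\<exists>t0\<in>{0..b}. \<forall>t\<in>{0..b}. poly q t0 \<le> poly q t"
    by (rule continuous_attains_inf) (use \<open>0 < b\<close> in \<open>auto intro: continuous_intros\<close>)
  then obtain t0 where t0: "t0 \<in> {0..b}" and min: "\<And>t. t \<in> {0..b} \<Longrightarrow> poly q t0 \<le> poly q t"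
    by blast
  define c where "c = poly q t0"
  have "0 \<le> c"
    unfolding c_def by (rule q[OF t0])
  show thesis
  proof (cases "q = [:c:]")
    case True
    then show thesis
      using const \<open>0 \<le> c\<close> by blast
  next
    case False
    have "poly (q - [:c:]) t0 = 0"
      by (simp add: c_def)
    then obtain h where h: "q - [:c:] = [:-t0, 1:] * h"
      unfolding poly_eq_0_iff_dvd by (elim dvdE)
    then have q_eq: "q = [:c:] + [:-t0, 1:] * h"
      by (simp add: algebra_simps)
    have "h \<noteq> 0"
      using False q_eq by auto
    have "degree q = Suc (degree h)"
    proof -
      have "degree ([:-t0, 1:] * h) = Suc (degree h)"
        using \<open>h \<noteq> 0\<close> by (subst degree_mult_eq) auto
      then show ?thesis
        unfolding q_eq by (subst degree_add_eq_right) auto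
    qed
    then have deg: "degree h < degree q"
      by simp
    have sgn: "0 \<le> (t - t0) * poly h t" if "t \<in> {0..b}" for t
      using min[OF that] arg_cong[OF h, of "\<lambda>p. poly p t"] by (simp add: c_def algebra_simps)
    consider "t0 = 0" | "t0 = b" | "0 < t0" "t0 < b"
      using t0 by fastforce
    then show thesis
    proof cases
      case 1
      have *: "0 \<le> poly h t" if "t \<in> {0..b}" "t \<noteq> 0" for t
        using sgn[OF that(1)] that 1 by (simp add: zero_le_mult_iff)
      have "0 \<le> poly h t" if "t \<in> {0..b}" for t
        using * that poly_nonneg_at_removed_point[OF \<open>0 < b\<close> _ *] by (cases "t = 0") auto
      then show thesis
        using step[OF \<open>0 \<le> c\<close> q_eq deg] 1 by simp
    next
      case 2
      have *: "0 \<le> poly (- h) t" if "t \<in> {0..b}" "t \<noteq> b" for t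
        using sgn[OF that(1)] that 2 by (simp add: zero_le_mult_iff)
      have "0 \<le> poly (- h) t" if "t \<in> {0..b}" for t
        using * that poly_nonneg_at_removed_point[OF \<open>0 < b\<close> _ *] by (cases "t = b") auto
      moreover have "q = [:c:] + [:b, -1:] * (- h)"
        using q_eq 2 by simp
      ultimately show thesis
        using step[OF \<open>0 \<le> c\<close>, of "[:b, -1:]" "- h"] deg by simp
    next
      case 3
      have right: "0 \<le> poly h t" if "t \<in> {t0..b}" "t \<noteq> t0" for t
        using sgn[of t] that 3 by (simp add: zero_le_mult_iff)
      have left: "0 \<le> poly (- h) t" if "t \<in> {0..t0}" "t \<noteq> t0" for t
        using sgn[of t] that 3 by (simp add: zero_le_mult_iff)
      \<comment> \<open>The quotient changes its sign at the minimum, so it has a root there as well.\<close>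
      have "0 \<le> poly h t0" "0 \<le> poly (- h) t0"
        using poly_nonneg_at_removed_point[OF 3(2) _ right]
          poly_nonneg_at_removed_point[OF 3(1) _ left] 3 by auto
      then have "poly h t0 = 0"
        by simp
      then obtain k where k: "h = [:-t0, 1:] * k"
        unfolding poly_eq_0_iff_dvd by (elim dvdE)
      have "k \<noteq> 0"
        using k \<open>h \<noteq> 0\<close> by auto
      then have "degree h = Suc (degree k)"
        unfolding k by (subst degree_mult_eq) auto
      then have degk: "degree k < degree q"
        using deg by simp
      have q_eq': "q = [:c:] + ([:-t0, 1:] * [:-t0, 1:]) * k"
        using q_eq k by (simp only: mult.assoc)
      have *: "0 \<le> poly k t" if "t \<in> {0..b}" "t \<noteq> t0" for t
      proof -
        have "0 \<le> (t - t0)\<^sup>2 * poly k t"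
          using sgn[OF that(1)] by (simp add: k power2_eq_square algebra_simps)
        then show ?thesis
          using that(2) by (simp add: zero_le_mult_iff)
      qed
      have "0 \<le> poly k t" if "t \<in> {0..b}" for t
        using * that poly_nonneg_at_removed_point[OF \<open>0 < b\<close> t0 *] by (cases "t = t0") auto
      then show thesis
        using step[OF \<open>0 \<le> c\<close> q_eq' degk] by blast
    qed
  qed
qed

locale nonneg_operator =
  fixes T :: "'a::{real_inner, complete_space} \<Rightarrow> 'a"
  assumes bounded_linear: "bounded_linear T"
    and self_adjoint: "inner (T x) y = inner x (T y)"
    and nonneg: "0 \<le> inner (T x) x"
begin

lemma linear: "linear T"
  using bounded_linear by (rule bounded_linear.linear)

lemma onorm_nonneg: "0 \<le> onorm T"
  by (rule onorm_pos_le[OF bounded_linear])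

lemma inner_le: "inner (T x) x \<le> onorm T * inner x x"
proof -
  have "inner (T x) x \<le> norm (T x) * norm x"
    by (rule norm_cauchy_schwarz)
  also have "\<dots> \<le> onorm T * norm x * norm x"
    by (intro mult_right_mono onorm[OF bounded_linear]) auto
  finally show ?thesis
    by (simp add: power2_norm_eq_inner[symmetric] power2_eq_square)
qed

text \<open>With \<open>b = \<parallel>T\<parallel>\<close>, this is nonnegativity of \<open>T (b - T)\<close>; it comes from
  \<open>b T (b - T) = (b - T) T (b - T) + T (b - T) T\<close>.\<close>

lemma inner_square_le: "inner (T x) (T x) \<le> onorm T * inner (T x) x"
proof (cases "onorm T = 0")
  case True
  then show ?thesis
    using onorm_eq_0[OF bounded_linear] by simp
next
  case False
  let ?b = "onorm T"
  have b: "?b > 0"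
    using False onorm_nonneg by simp
  let ?z = "?b *\<^sub>R x - T x"
  interpret T: linear T by (rule linear)
  have "?b * (?b * inner (T x) x - inner (T x) (T x))
      = inner (T ?z) ?z + (?b * inner (T x) (T x) - inner (T (T x)) (T x))"
    by (simp add: T.diff T.scale inner_diff_left inner_diff_right self_adjoint[of "T x"]
        self_adjoint[of x] inner_commute algebra_simps)
  also have "\<dots> \<ge> 0"
    using nonneg[of ?z] inner_le[of "T x"] by linarith
  finally show ?thesis
    using b by (simp add: zero_le_mult_iff)
qed

text \<open>The weights \<open>f\<close> make the induction over \<open>nonneg_poly_reduction\<close> work: up to the square of a
  polynomial, which can be moved to the vector, they are closed under multiplication by each of the
  three factors that are split off there.\<close>

lemma poly_op_nonneg_weighted:
  assumes "0 < onorm T" and q: "\<And>t. t \<in> {0..onorm T} \<Longrightarrow> 0 \<le> poly q t"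
    and f: "f \<in> {1, [:0, 1:], [:onorm T, -1:], [:0, 1:] * [:onorm T, -1:]}"
  shows "0 \<le> inner (poly_op (f * q) T x) x"
  using q f
proof (induction "degree q" arbitrary: q f x rule: less_induct)
  case less
  define b where "b = onorm T"
  note lin = poly_op_mult[OF linear] poly_op_add[OF linear] poly_op_smult[OF linear]
    poly_op_pCons[OF linear]
  have weight: "0 \<le> inner (poly_op f T x) x" if "f \<in> {1, [:0, 1:], [:b, -1:], [:0, 1:] * [:b, -1:]}" for f x
    using that nonneg[of x] inner_le[of x] inner_square_le[of x]
    unfolding b_def
    by (auto simp: lin linear_diff[OF linear] linear_scale[OF linear] linear_0[OF linear]
        linear_neg[OF linear] linear_add[OF linear] inner_diff_left inner_add_left
        self_adjoint[of "T x" x] simp del: mult_pCons_left mult_pCons_right)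
  from less.prems(1) consider (const) c where "0 \<le> c" "q = [:c:]"
    | (step) c g h t0 where "0 \<le> c" "q = [:c:] + g * h" "degree h < degree q"
      "g = [:0, 1:] \<or> g = [:b, -1:] \<or> g = [:-t0, 1:] * [:-t0, 1:]"
      "\<And>t. t \<in> {0..b} \<Longrightarrow> 0 \<le> poly h t"
    using nonneg_poly_reduction[of b q] \<open>0 < onorm T\<close> unfolding b_def by metis
  then show ?case
  proof cases
    case const
    then show ?thesis
      using weight[of f x] less.prems(2) by (simp add: lin b_def)
  next
    case step
    define X :: "real poly" where "X = [:0, 1:]"
    define Y where "Y = [:b, -1:]"
    define Z where "Z = [:-t0, 1:]"
    have f: "f = 1 \<or> f = X \<or> f = Y \<or> f = X * Y" and g: "g = X \<or> g = Y \<or> g = Z * Z"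
      using less.prems(2) step(4) by (auto simp: X_def Y_def Z_def b_def)
    have "\<exists>s f'. f * g = s * (f' * s) \<and> (f' = 1 \<or> f' = X \<or> f' = Y \<or> f' = X * Y)"
      using g
    proof (elim disjE)
      assume "g = X"
      with f show ?thesis
        by (elim disjE) (rule exI[of _ 1] exI[of _ X], force simp: mult_ac)+
    next
      assume "g = Y"
      with f show ?thesis
        by (elim disjE) (rule exI[of _ 1] exI[of _ Y], force simp: mult_ac)+
    next
      assume "g = Z * Z"
      with f show ?thesis
        by (intro exI[of _ Z] exI[of _ f]) (auto simp: mult_ac)
    qed
    then obtain s f' where s: "f * g = s * (f' * s)"
      and f': "f' \<in> {1, [:0, 1:], [:onorm T, -1:], [:0, 1:] * [:onorm T, -1:]}"
      by (auto simp: X_def Y_def b_def)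
    have "f * q = smult c f + s * ((f' * h) * s)"
      using s by (simp add: step(2) algebra_simps)
    then have "inner (poly_op (f * q) T x) x = c * inner (poly_op f T x) x
        + inner (poly_op (f' * h) T (poly_op s T x)) (poly_op s T x)"
      by (simp add: lin inner_add_left poly_op_self_adjoint[OF linear self_adjoint, of s])
    moreover have "0 \<le> inner (poly_op (f' * h) T (poly_op s T x)) (poly_op s T x)"
      using less.hyps[OF step(3) _ f'] step(5) by (simp add: b_def)
    ultimately show ?thesis
      using weight[of f x] step(1) less.prems(2) by (simp add: b_def)
  qed
qed

lemma poly_op_nonneg:
  assumes q: "\<And>t. t \<in> {0..onorm T} \<Longrightarrow> 0 \<le> poly q t"
  shows "0 \<le> inner (poly_op q T x) x"
proof (cases "onorm T = 0")
  case True
  then have "T x = 0" for x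
    using onorm_eq_0[OF bounded_linear] by simp
  then have "poly_op q T x = poly q 0 *\<^sub>R x"
    by (cases q) (simp add: poly_op_pCons[OF linear])
  then show ?thesis
    using q[of 0] True by simp
next
  case False
  then show ?thesis
    using poly_op_nonneg_weighted[of q 1 x] onorm_nonneg q by simp
qed

text \<open>Apply nonnegativity to the polynomial \<open>M\<^sup>2 - p\<^sup>2\<close>.\<close>

lemma poly_op_norm_le:
  assumes "0 \<le> M" and p: "\<And>t. t \<in> {0..onorm T} \<Longrightarrow> \<bar>poly p t\<bar> \<le> M"
  shows "norm (poly_op p T x) \<le> M * norm x"
proof (rule power2_le_imp_le)
  have "0 \<le> inner (poly_op ([:M\<^sup>2:] - p * p) T x) x"
  proof (rule poly_op_nonneg)
    fix t assume "t \<in> {0..onorm T}"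
    then have "(poly p t)\<^sup>2 \<le> M\<^sup>2"
      using power_mono[OF p abs_ge_zero, of t 2] by simp
    then show "0 \<le> poly ([:M\<^sup>2:] - p * p) t"
      by (simp add: power2_eq_square)
  qed
  then show "(norm (poly_op p T x))\<^sup>2 \<le> (M * norm x)\<^sup>2"
    by (simp add: poly_op_diff[OF linear] poly_op_mult[OF linear] inner_diff_left
        poly_op_self_adjoint[OF linear self_adjoint, of p] power2_norm_eq_inner power_mult_distrib)
qed (use \<open>0 \<le> M\<close> in auto)

lemma poly_op_bounded_linear: "bounded_linear (poly_op p T)"
proof (induction p)
  case 0
  have "poly_op 0 T = (\<lambda>x. 0)"
    by auto
  then show ?case
    by simp
next
  case (pCons a p)
  have "poly_op (pCons a p) T = (\<lambda>x. a *\<^sub>R x + T (poly_op p T x))"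
    by (simp add: fun_eq_iff poly_op_pCons[OF linear])
  then show ?case
    using pCons.IH by (auto intro!: bounded_linear_add bounded_linear_scaleR_right
        bounded_linear_compose[OF bounded_linear])
qed

end

section \<open>Fractional powers and approximate sources\<close>

lemma Weierstrass_poly:
  fixes f :: "real \<Rightarrow> real"
  assumes "continuous_on {a..b} f" "0 < e"
  obtains p :: "real poly" where "\<And>t. t \<in> {a..b} \<Longrightarrow> \<bar>poly p t - f t\<bar> < e"
proof -
  obtain g where g: "real_polynomial_function g" "\<And>t. t \<in> {a..b} \<Longrightarrow> \<bar>f t - g t\<bar> < e"
    using Stone_Weierstrass_real_polynomial_function[OF compact_Icc assms] by blast
  then obtain c n where c: "g = (\<lambda>x. \<Sum>i\<le>n. c i * x ^ i)"
    by (auto simp: real_polynomial_function_iff_sum)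
  have "poly (\<Sum>i\<le>n. monom (c i) i) = g"
    unfolding c by (simp add: poly_sum poly_monom fun_eq_iff)
  then show thesis
    using g(2) by (intro that[of "\<Sum>i\<le>n. monom (c i) i"]) (simp add: abs_minus_commute)
qed

context nonneg_operator
begin

text \<open>By \<open>poly_op_norm_le\<close>, the values at \<open>T\<close> of polynomials that converge uniformly to \<open>t\<^sup>s\<close> form a
  Cauchy sequence in the operator norm; \<open>B\<close> is its limit.\<close>

lemma fractional_power_exists:
  assumes "0 < s"
  shows "\<exists>B. bounded_linear B \<and> (\<forall>p e. (\<forall>t\<in>{0..onorm T}. \<bar>poly p t - t powr s\<bar> \<le> e) \<longrightarrow>
    (\<forall>x. norm (poly_op p T x - B x) \<le> e * norm x))"
proof -
  let ?I = "{0..onorm T}"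
  let ?r = "\<lambda>k. 1 / real (Suc k)"
  have r0: "?r \<longlonglongrightarrow> 0"
    using LIMSEQ_inverse_real_of_nat by (simp add: inverse_eq_divide)
  have cont: "continuous_on ?I (\<lambda>t. t powr s)"
    using \<open>0 < s\<close> by (intro continuous_on_powr' continuous_intros) auto
  have "\<exists>p. \<forall>t\<in>?I. \<bar>poly p t - t powr s\<bar> < ?r k" for k
    using Weierstrass_poly[OF cont, of "?r k"] by (metis divide_pos_pos of_nat_0_less_iff zero_less_Suc zero_less_one)
  then obtain P where P: "\<And>k t. t \<in> ?I \<Longrightarrow> \<bar>poly (P k) t - t powr s\<bar> < ?r k"
    by metis
  have close: "norm (poly_op q T x - poly_op (P k) T x) \<le> (e + ?r k) * norm x"
    if q: "\<And>t. t \<in> ?I \<Longrightarrow> \<bar>poly q t - t powr s\<bar> \<le> e" for q e k x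
  proof -
    have "0 \<le> e"
      using q[of 0] onorm_nonneg by force
    have "\<bar>poly (q - P k) t\<bar> \<le> e + ?r k" if "t \<in> ?I" for t
      using q[OF that] P[OF that, of k] by simp
    then have "norm (poly_op (q - P k) T x) \<le> (e + ?r k) * norm x"
      using \<open>0 \<le> e\<close> by (intro poly_op_norm_le) auto
    then show ?thesis
      by (simp add: poly_op_diff[OF linear])
  qed
  define B where "B x = lim (\<lambda>k. poly_op (P k) T x)" for x
  have lim: "(\<lambda>k. poly_op (P k) T x) \<longlonglongrightarrow> B x" for x
  proof -
    have "Cauchy (\<lambda>k. poly_op (P k) T x)"
    proof (rule CauchyI')
      fix e :: real assume "e > 0"
      have "(\<lambda>k. (?r k + ?r k) * norm x) \<longlonglongrightarrow> (0 + 0) * norm x"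
        by (intro tendsto_intros r0)
      then have "\<forall>\<^sub>F k in sequentially. (?r k + ?r k) * norm x < e"
        using order_tendstoD(2)[of _ 0 _ e] \<open>e > 0\<close> by simp
      then obtain M where M: "\<And>k. k \<ge> M \<Longrightarrow> (?r k + ?r k) * norm x < e"
        unfolding eventually_sequentially by auto
      have "norm (poly_op (P m) T x - poly_op (P k) T x) < e" if "m \<ge> M" "m < k" for m k
      proof -
        have "norm (poly_op (P m) T x - poly_op (P k) T x) \<le> (?r m + ?r k) * norm x"
          using P by (intro close) (auto intro: less_imp_le)
        also have "\<dots> \<le> (?r m + ?r m) * norm x"
          using that by (intro mult_right_mono add_left_mono) (auto simp: frac_le)
        also have "\<dots> < e"
          using M that by simp
        finally show ?thesis .
      qed
      then show "\<exists>M. \<forall>m\<ge>M. \<forall>n>m. dist (poly_op (P m) T x) (poly_op (P n) T x) < e"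
        unfolding dist_norm by blast
    qed
    then show ?thesis
      unfolding B_def by (intro convergent_LIMSEQ_iff[THEN iffD1] Cauchy_convergent)
  qed
  have approx: "norm (poly_op q T x - B x) \<le> e * norm x"
    if q: "\<forall>t\<in>?I. \<bar>poly q t - t powr s\<bar> \<le> e" for q e x
  proof (rule LIMSEQ_le)
    show "(\<lambda>k. norm (poly_op q T x - poly_op (P k) T x)) \<longlonglongrightarrow> norm (poly_op q T x - B x)"
      by (intro tendsto_intros lim)
    have "(\<lambda>k. (e + ?r k) * norm x) \<longlonglongrightarrow> (e + 0) * norm x"
      by (intro tendsto_intros r0)
    then show "(\<lambda>k. (e + ?r k) * norm x) \<longlonglongrightarrow> e * norm x"
      by simp
  qed (use close q in blast)
  have "bounded_linear B"
  proof (rule bounded_linear_intro)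
    fix x y :: 'a and c :: real
    have "(\<lambda>k. poly_op (P k) T (x + y)) \<longlonglongrightarrow> B x + B y"
      using tendsto_add[OF lim[of x] lim[of y]] by (simp add: linear_add[OF poly_op_linear[OF linear]])
    then show "B (x + y) = B x + B y"
      using LIMSEQ_unique lim by blast
    have "(\<lambda>k. poly_op (P k) T (c *\<^sub>R x)) \<longlonglongrightarrow> c *\<^sub>R B x"
      using tendsto_scaleR[OF tendsto_const[of c] lim[of x]]
      by (simp add: linear_scale[OF poly_op_linear[OF linear]])
    then show "B (c *\<^sub>R x) = c *\<^sub>R B x"
      using LIMSEQ_unique lim by blast
    have "norm (poly_op (P 0) T x - B x) \<le> 1 * norm x"
      using P[of _ 0] by (intro approx) (auto intro: less_imp_le)
    moreover have "norm (poly_op (P 0) T x) \<le> onorm (poly_op (P 0) T) * norm x"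
      by (rule onorm[OF poly_op_bounded_linear])
    moreover have "norm (B x) \<le> norm (poly_op (P 0) T x) + norm (poly_op (P 0) T x - B x)"
      by (metis norm_minus_commute norm_triangle_sub)
    ultimately show "norm (B x) \<le> norm x * (onorm (poly_op (P 0) T) + 1)"
      by (simp add: algebra_simps)
  qed
  then show ?thesis
    using approx by blast
qed

text \<open>The operator \<open>B\<close> above has the property that defines \<open>frac_power\<close>, and a single uniformly convergent
  sequence of polynomials determines it. The estimate for individual polynomials makes it possible to work
  with fractional powers without passing to limits.\<close>

lemma frac_power_approx:
  assumes "0 < s" and p: "\<And>t. t \<in> {0..onorm T} \<Longrightarrow> \<bar>poly p t - t powr s\<bar> \<le> e"
  shows "norm (poly_op p T x - frac_power T s x) \<le> e * norm x"
proof -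
  let ?I = "{0..onorm T}"
  obtain B where B: "bounded_linear B" and
    approx: "\<And>p e x. \<forall>t\<in>?I. \<bar>poly p t - t powr s\<bar> \<le> e \<Longrightarrow> norm (poly_op p T x - B x) \<le> e * norm x"
    using fractional_power_exists[OF \<open>0 < s\<close>] by blast
  have bl: "bounded_linear (\<lambda>x. poly_op q T x - D x)" if "bounded_linear D" for q D
    using that by (intro bounded_linear_sub poly_op_bounded_linear)
  have onorm_lim: "(\<lambda>k. onorm (\<lambda>x. poly_op (q k) T x - B x)) \<longlonglongrightarrow> 0"
    if q: "uniform_limit ?I (\<lambda>k t. poly (q k) t) (\<lambda>t. t powr s) sequentially" for q :: "nat \<Rightarrow> real poly"
  proof (rule tendstoI)
    fix r :: real assume "r > 0"
    then have "\<forall>\<^sub>F k in sequentially. \<forall>t\<in>?I. dist (poly (q k) t) (t powr s) < r / 2"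
      by (intro uniform_limitD[OF q]) simp
    then show "\<forall>\<^sub>F k in sequentially. dist (onorm (\<lambda>x. poly_op (q k) T x - B x)) 0 < r"
    proof eventually_elim
      case (elim k)
      have "onorm (\<lambda>x. poly_op (q k) T x - B x) \<le> r / 2"
        using elim \<open>r > 0\<close>
        by (intro onorm_bound approx) (auto simp: dist_real_def intro: less_imp_le)
      then show ?case
        using onorm_pos_le[OF bl[OF B, of "q k"]] \<open>r > 0\<close> by simp
    qed
  qed
  have cont: "continuous_on ?I (\<lambda>t. t powr s)"
    using \<open>0 < s\<close> by (intro continuous_on_powr' continuous_intros) auto
  have "\<exists>p. \<forall>t\<in>?I. \<bar>poly p t - t powr s\<bar> < 1 / real (Suc k)" for k
    using Weierstrass_poly[OF cont, of "1 / real (Suc k)"]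
    by (metis divide_pos_pos of_nat_0_less_iff zero_less_Suc zero_less_one)
  then obtain P where P: "\<And>k t. t \<in> ?I \<Longrightarrow> \<bar>poly (P k) t - t powr s\<bar> < 1 / real (Suc k)"
    by metis
  have ul: "uniform_limit ?I (\<lambda>k t. poly (P k) t) (\<lambda>t. t powr s) sequentially"
    unfolding uniform_limit_iff
  proof (intro allI impI)
    fix r :: real assume "r > 0"
    then have "\<forall>\<^sub>F k in sequentially. inverse (real (Suc k)) < r"
      using order_tendstoD(2)[OF LIMSEQ_inverse_real_of_nat] by blast
    then show "\<forall>\<^sub>F k in sequentially. \<forall>t\<in>?I. dist (poly (P k) t) (t powr s) < r"
      by eventually_elim (metis P dist_real_def inverse_eq_divide order_less_trans)
  qed
  have conv: "(\<lambda>k. poly_op (P k) T x) \<longlonglongrightarrow> D x"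
    if "bounded_linear D" "(\<lambda>k. onorm (\<lambda>x. poly_op (P k) T x - D x)) \<longlonglongrightarrow> 0" for D x
  proof -
    have "(\<lambda>k. onorm (\<lambda>x. poly_op (P k) T x - D x) * norm x) \<longlonglongrightarrow> 0"
      using tendsto_mult_right[OF that(2), of "norm x"] by simp
    then have "(\<lambda>k. poly_op (P k) T x - D x) \<longlonglongrightarrow> 0"
      by (rule Lim_null_comparison[rotated]) (use onorm[OF bl[OF that(1)]] in auto)
    then show ?thesis
      by (simp add: LIM_zero_iff)
  qed
  have "frac_power T s = B"
    unfolding frac_power_def
  proof (rule the_equality)
    fix D assume D: "bounded_linear D \<and> (\<forall>p. uniform_limit ?I (\<lambda>k t. poly (p k) t) (\<lambda>t. t powr s) sequentially
      \<longrightarrow> (\<lambda>k. onorm (\<lambda>x. poly_op (p k) T x - D x)) \<longlonglongrightarrow> 0)"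
    show "D = B"
    proof
      fix x
      have "(\<lambda>k. poly_op (P k) T x) \<longlonglongrightarrow> D x"
        using D ul by (intro conv) auto
      then show "D x = B x"
        using conv[OF B onorm_lim[OF ul]] LIMSEQ_unique by blast
    qed
  qed (use B onorm_lim in blast)
  then show ?thesis
    using approx p by simp
qed

end

lemma powr_interpolation_le:
  fixes a t r :: real
  assumes "0 < a" "0 \<le> t" "0 \<le> r" "r \<le> 1"
  shows "a powr (1 - r) * t powr r \<le> t + a"
proof (cases "t = 0")
  case False
  have "t powr r * a powr (1 - r) \<le> r * t + (1 - r) * a"
    using assms False by (intro Youngs_inequality_0) auto
  also have "\<dots> \<le> 1 * t + 1 * a"
    using assms by (intro add_mono mult_right_mono) auto
  finally show ?thesis
    by (simp add: mult.commute)
qed (use assms in auto)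

text \<open>The Tikhonov-regularised solution \<open>A (A\<^sup>*A + \<alpha>)\<^sup>-\<^sup>1 (A\<^sup>*A)\<^sup>s \<omega>\<close> of the equation
  \<open>A\<^sup>*\<mu> = (A\<^sup>*A)\<^sup>s \<omega>\<close> satisfies both estimates with constant 1. Replacing the function
  \<open>t\<^sup>s / (t + \<alpha>)\<close> of \<open>A\<^sup>*A\<close> by a polynomial \<open>g\<close> that is uniformly close to it costs the factor 2.\<close>

lemma frac_power_approx_in_range:
  fixes A :: "'a::{real_inner, complete_space} \<Rightarrow> 'b::real_inner"
  assumes A: "bounded_linear A" and s: "0 < s" "s \<le> 1/2" and "0 < \<alpha>"
  shows "\<exists>\<mu>. norm (adjoint A \<mu> - frac_power (adjoint A \<circ> A) s \<omega>) \<le> 2 * \<alpha> powr s * norm \<omega> \<and>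
    norm \<mu> \<le> 2 * \<alpha> powr (s - 1/2) * norm \<omega>"
proof -
  define T where "T = adjoint A \<circ> A"
  interpret T: nonneg_operator T
  proof (rule nonneg_operator.intro)
    show "bounded_linear T"
      unfolding T_def comp_def by (intro bounded_linear_compose[OF adjoint_bounded_linear] A)
    have *: "inner (T x) y = inner (A x) (A y)" for x y
      by (metis T_def adjoint_inner[OF A] comp_apply inner_commute)
    show "inner (T x) y = inner x (T y)" for x y
      by (metis * inner_commute)
    show "0 \<le> inner (T x) x" for x
      by (simp add: *)
  qed
  note lin = T.linear
  let ?I = "{0..onorm T}"
  define b where "b = onorm T"
  have "0 \<le> b"
    unfolding b_def by (rule T.onorm_nonneg)
  define f where "f t = t powr s / (t + \<alpha>)" for t
  define \<eta> where "\<eta> = min (\<alpha> powr s / (b + 1)) (\<alpha> powr (s - 1/2) / (sqrt b + 1))"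
  have "0 < \<eta>"
    using \<open>0 < \<alpha>\<close> \<open>0 \<le> b\<close> by (simp add: \<eta>_def add_nonneg_pos)
  have \<eta>1: "b * \<eta> \<le> \<alpha> powr s"
  proof -
    have "b * \<eta> \<le> (b + 1) * (\<alpha> powr s / (b + 1))"
      using \<open>0 \<le> b\<close> \<open>0 < \<eta>\<close> by (intro mult_mono) (auto simp: \<eta>_def)
    then show ?thesis
      using \<open>0 \<le> b\<close> by simp
  qed
  have \<eta>2: "sqrt b * \<eta> \<le> \<alpha> powr (s - 1/2)"
  proof -
    have "sqrt b * \<eta> \<le> (sqrt b + 1) * (\<alpha> powr (s - 1/2) / (sqrt b + 1))"
      using \<open>0 \<le> b\<close> \<open>0 < \<eta>\<close> by (intro mult_mono) (auto simp: \<eta>_def)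
    moreover have "sqrt b + 1 > 0"
      using \<open>0 \<le> b\<close> by (simp add: add_nonneg_pos)
    ultimately show ?thesis
      by simp
  qed
  have "continuous_on ?I f"
    unfolding f_def using s \<open>0 < \<alpha>\<close> by (intro continuous_on_powr' continuous_intros) auto
  then obtain g where g: "\<And>t. t \<in> ?I \<Longrightarrow> \<bar>poly g t - f t\<bar> < \<eta>"
    using Weierstrass_poly \<open>0 < \<eta>\<close> by blast
  define X :: "real poly" where "X = [:0, 1:]"
  have X: "poly_op X T x = T x" for x
    by (simp add: X_def poly_op_pCons[OF lin] linear_0[OF lin])
  define \<mu> where "\<mu> = A (poly_op g T \<omega>)"

  have "\<bar>poly (X * g) t - t powr s\<bar> \<le> 2 * \<alpha> powr s" if "t \<in> ?I" for t
  proof -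
    have t: "0 \<le> t" "t \<le> b"
      using that by (auto simp: b_def)
    have "\<bar>t * (poly g t - f t)\<bar> \<le> b * \<eta>"
      unfolding abs_mult using t g[OF that] by (intro mult_mono) auto
    moreover have "\<bar>t * f t - t powr s\<bar> \<le> \<alpha> powr s"
    proof -
      have "t * f t - t powr s = - (\<alpha> * t powr s / (t + \<alpha>))"
        using t \<open>0 < \<alpha>\<close> by (simp add: f_def field_simps)
      moreover have "\<alpha> * t powr s \<le> \<alpha> powr s * (t + \<alpha>)"
      proof -
        have "\<alpha> * t powr s = \<alpha> powr s * (\<alpha> powr (1 - s) * t powr s)"
          using \<open>0 < \<alpha>\<close> by (simp add: powr_add[symmetric] flip: mult.assoc)
        also have "\<dots> \<le> \<alpha> powr s * (t + \<alpha>)"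
          using s t \<open>0 < \<alpha>\<close> by (intro mult_left_mono powr_interpolation_le) auto
        finally show ?thesis .
      qed
      ultimately show ?thesis
        using t \<open>0 < \<alpha>\<close> by (simp add: divide_le_eq abs_mult)
    qed
    ultimately show ?thesis
      using \<eta>1 by (simp add: X_def algebra_simps)
  qed
  then have "norm (poly_op (X * g) T \<omega> - frac_power T s \<omega>) \<le> 2 * \<alpha> powr s * norm \<omega>"
    by (rule T.frac_power_approx[OF s(1)])
  moreover have "poly_op (X * g) T \<omega> = adjoint A \<mu>"
    by (simp add: poly_op_mult[OF lin] X \<mu>_def) (simp add: T_def)
  ultimately have 1: "norm (adjoint A \<mu> - frac_power T s \<omega>) \<le> 2 * \<alpha> powr s * norm \<omega>"
    by simp

  define M where "M = 2 * \<alpha> powr (s - 1/2)"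
  have "0 \<le> M"
    by (simp add: M_def)
  have "\<bar>poly (g * (X * g)) t\<bar> \<le> M\<^sup>2" if "t \<in> ?I" for t
  proof -
    have t: "0 \<le> t" "t \<le> b"
      using that by (auto simp: b_def)
    have "sqrt t * \<bar>poly g t - f t\<bar> \<le> sqrt b * \<eta>"
      using t g[OF that] by (intro mult_mono) auto
    moreover have "sqrt t * f t \<le> \<alpha> powr (s - 1/2)"
    proof -
      have "sqrt t * t powr s = \<alpha> powr (s - 1/2) * (\<alpha> powr (1 - (s + 1/2)) * t powr (s + 1/2))"
        using \<open>0 < \<alpha>\<close> t
        by (simp add: powr_half_sqrt[symmetric] powr_add[symmetric] add.commute flip: mult.assoc)
      also have "\<dots> \<le> \<alpha> powr (s - 1/2) * (t + \<alpha>)"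
        using s t \<open>0 < \<alpha>\<close> by (intro mult_left_mono powr_interpolation_le) auto
      finally show ?thesis
        using t \<open>0 < \<alpha>\<close> by (simp add: f_def divide_le_eq)
    qed
    moreover have "0 \<le> f t"
      using t \<open>0 < \<alpha>\<close> by (simp add: f_def)
    moreover have "sqrt t * \<bar>poly g t\<bar> \<le> sqrt t * \<bar>poly g t - f t\<bar> + sqrt t * \<bar>f t\<bar>"
      using t unfolding distrib_left[symmetric] by (intro mult_left_mono) auto
    ultimately have "sqrt t * \<bar>poly g t\<bar> \<le> M"
      using \<eta>2 by (simp add: M_def)
    then have "(sqrt t * \<bar>poly g t\<bar>)\<^sup>2 \<le> M\<^sup>2"
      using t by (intro power_mono) auto
    moreover have "poly (g * (X * g)) t = t * (poly g t)\<^sup>2"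
      by (simp add: X_def power2_eq_square)
    ultimately show ?thesis
      using t by (simp add: power_mult_distrib)
  qed
  then have "norm (poly_op (g * (X * g)) T \<omega>) \<le> M\<^sup>2 * norm \<omega>"
    by (intro T.poly_op_norm_le) auto
  moreover have "(norm \<mu>)\<^sup>2 = inner (poly_op (g * (X * g)) T \<omega>) \<omega>"
  proof -
    have "(norm \<mu>)\<^sup>2 = inner (poly_op g T \<omega>) (T (poly_op g T \<omega>))"
      by (simp add: \<mu>_def T_def adjoint_inner[OF A] power2_norm_eq_inner)
    then show ?thesis
      by (simp add: poly_op_mult[OF lin] X poly_op_self_adjoint[OF lin T.self_adjoint] inner_commute
          T.self_adjoint)
  qed
  moreover have "inner (poly_op (g * (X * g)) T \<omega>) \<omega> \<le> norm (poly_op (g * (X * g)) T \<omega>) * norm \<omega>"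
    by (rule norm_cauchy_schwarz)
  ultimately have "(norm \<mu>)\<^sup>2 \<le> M\<^sup>2 * norm \<omega> * norm \<omega>"
    using mult_right_mono[of "norm (poly_op (g * (X * g)) T \<omega>)" "M\<^sup>2 * norm \<omega>" "norm \<omega>"] by simp
  then have "(norm \<mu>)\<^sup>2 \<le> (M * norm \<omega>)\<^sup>2"
    by (simp add: power_mult_distrib power2_eq_square mult_ac)
  then have "norm \<mu> \<le> M * norm \<omega>"
    by (rule power2_le_imp_le) (use \<open>0 \<le> M\<close> in simp)
  with 1 show ?thesis
    unfolding M_def T_def by blast
qed

section \<open>The conjugate of the energy on a convex set\<close>

text \<open>For nonempty, closed and convex \<open>C\<close> this is \<open>sup {\<xi> \<bullet> w - \<parallel>w\<parallel>\<^sup>2 / 2 | w \<in> C}\<close>, the convex conjugate of \<open>\<parallel>w\<parallel>\<^sup>2 / 2\<close> restricted to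
  \<open>C\<close>; its gradient is \<open>metric_proj C\<close>.\<close>

definition energy_conj :: "'a::real_inner set \<Rightarrow> 'a \<Rightarrow> real" where
  "energy_conj C \<xi> = inner \<xi> (metric_proj C \<xi>) - (norm (metric_proj C \<xi>))\<^sup>2 / 2"

lemma energy_conj_strong_max:
  fixes C :: "'a::{real_inner, complete_space} set"
  assumes "closed C" "convex C" "w \<in> C"
  shows "inner \<xi> w - (norm w)\<^sup>2 / 2 + (norm (w - metric_proj C \<xi>))\<^sup>2 / 2 \<le> energy_conj C \<xi>"
proof -
  have "C \<noteq> {}"
    using \<open>w \<in> C\<close> by auto
  then show ?thesis
    using metric_proj_dot[OF assms(1,2) _ assms(3), of \<xi>]
    unfolding energy_conj_def power2_norm_eq_inner
    by (simp add: inner_diff_left inner_diff_right inner_commute field_simps)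
qed

lemma energy_conj_convex:
  fixes C :: "'a::{real_inner, complete_space} set"
  assumes "closed C" "convex C" "C \<noteq> {}"
  shows "energy_conj C \<xi> + inner (metric_proj C \<xi>) (\<eta> - \<xi>) \<le> energy_conj C \<eta>"
proof -
  have "inner (metric_proj C \<xi>) (\<eta> - \<xi>) = inner \<eta> (metric_proj C \<xi>) - inner \<xi> (metric_proj C \<xi>)"
    by (simp add: inner_diff_right inner_commute)
  moreover have "0 \<le> (norm (metric_proj C \<xi> - metric_proj C \<eta>))\<^sup>2 / 2"
    by simp
  ultimately show ?thesis
    using energy_conj_strong_max[OF assms(1,2) metric_proj_in[OF assms], of \<eta> \<xi>]
    unfolding energy_conj_def[of C \<xi>] by linarith
qed

text \<open>The supremum for \<open>\<eta>\<close> is attained at \<open>metric_proj C \<eta>\<close>; inserting this point into the strong maximum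
  property at \<open>\<xi>\<close> leaves a linear term in its distance from \<open>metric_proj C \<xi>\<close>, which the quadratic term absorbs.\<close>

lemma energy_conj_smooth:
  fixes C :: "'a::{real_inner, complete_space} set"
  assumes "closed C" "convex C" "C \<noteq> {}"
  shows "energy_conj C \<eta> \<le>
    energy_conj C \<xi> + inner (metric_proj C \<xi>) (\<eta> - \<xi>) + (norm (\<eta> - \<xi>))\<^sup>2 / 2"
proof -
  let ?d = "metric_proj C \<eta> - metric_proj C \<xi>"
  have "inner u v \<le> (norm v)\<^sup>2 / 2 + (norm u)\<^sup>2 / 2" for u v :: 'a
    using zero_le_power2[of "norm (v - u)"] unfolding power2_norm_eq_inner
    by (simp add: inner_diff_left inner_diff_right inner_commute field_simps del: inner_ge_zero)
  from this[of "\<eta> - \<xi>" ?d] have "inner (\<eta> - \<xi>) ?d \<le> (norm ?d)\<^sup>2 / 2 + (norm (\<eta> - \<xi>))\<^sup>2 / 2" .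
  then show ?thesis
    using energy_conj_strong_max[OF assms(1,2) metric_proj_in[OF assms], of \<xi> \<eta>]
    unfolding energy_conj_def[of C \<eta>] by (simp add: inner_diff_left inner_diff_right inner_commute)
qed

section \<open>Gradient descent\<close>

lemma mult_le_weighted_squares:
  fixes \<gamma> c t :: real
  assumes "0 < \<gamma>"
  shows "c * t \<le> t\<^sup>2 / (2 * \<gamma>) + \<gamma> * c\<^sup>2 / 2"
proof -
  have "0 \<le> (t - \<gamma> * c)\<^sup>2 / (2 * \<gamma>)"
    using assms by simp
  also have "\<dots> = t\<^sup>2 / (2 * \<gamma>) + \<gamma> * c\<^sup>2 / 2 - c * t"
    using assms by (simp add: power2_eq_square field_simps)
  finally show ?thesis
    by simp
qed

lemma le_add_if_square_le:
  fixes a b u :: real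
  assumes "u\<^sup>2 \<le> a * u + b\<^sup>2" "0 \<le> a" "0 \<le> b"
  shows "u \<le> a + b"
proof (rule ccontr)
  assume "\<not> ?thesis"
  then have u: "a + b < u"
    by simp
  then have "b * b \<le> b * u" and "(a + b) * u < u * u"
    using assms by (intro mult_left_mono mult_strict_right_mono; linarith)+
  then show False
    using assms(1) by (simp add: power2_eq_square algebra_simps)
qed

text \<open>The left-hand side is a Lyapunov function, nonincreasing in \<open>n\<close>: the decrease of \<open>J\<close> by
  \<open>\<gamma> (1 - \<gamma> L / 2) \<parallel>G\<parallel>\<^sup>2\<close> in each step is counted \<open>n\<close> times, and every step at which the gradient
  is large pays for the growth of the term with \<open>\<rho>\<close>.\<close>

lemma gradient_descent_estimate:
  fixes J :: "'b::real_inner \<Rightarrow> real" and G :: "'b \<Rightarrow> 'b" and l :: "nat \<Rightarrow> 'b"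
  assumes convex: "\<And>u v. J u + inner (G u) (v - u) \<le> J v"
    and smooth: "\<And>u v. J v \<le> J u + inner (G u) (v - u) + L / 2 * (norm (v - u))\<^sup>2"
    and step: "\<And>k. l (Suc k) = l k - \<gamma> *\<^sub>R G (l k)"
    and "0 < \<gamma>" "0 \<le> L" "\<gamma> * L \<le> 1"
    and grad: "\<And>k. k < n \<Longrightarrow> \<rho> \<le> (norm (G (l k)))\<^sup>2"
  shows "real n * (J (l n) - J m) + (norm (l n - m))\<^sup>2 / (2 * \<gamma>)
      + \<rho> * \<gamma> * (1 - \<gamma> * L) / 2 * (real n)\<^sup>2 \<le> (norm (l 0 - m))\<^sup>2 / (2 * \<gamma>)"
  using grad
proof (induction n)
  case 0
  show ?case by simp
next
  case (Suc n)
  define g where "g = G (l n)"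
  define N where "N = (norm g)\<^sup>2"
  define \<kappa> where "\<kappa> = \<gamma> * (1 - \<gamma> * L)"
  have "0 \<le> \<kappa>" "0 \<le> N"
    using \<open>0 < \<gamma>\<close> \<open>\<gamma> * L \<le> 1\<close> by (auto simp: \<kappa>_def N_def)
  have descent: "J (l (Suc n)) \<le> J (l n) - (\<gamma> - \<gamma>\<^sup>2 * L / 2) * N"
    using smooth[of "l (Suc n)" "l n"]
    by (simp add: step g_def[symmetric] N_def power_mult_distrib dot_square_norm algebra_simps)
  have "\<kappa> \<le> \<gamma> - \<gamma>\<^sup>2 * L / 2"
    using \<open>0 \<le> L\<close> by (simp add: \<kappa>_def power2_eq_square algebra_simps)
  then have "\<kappa> * N \<le> (\<gamma> - \<gamma>\<^sup>2 * L / 2) * N"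
    using \<open>0 \<le> N\<close> by (rule mult_right_mono)
  then have "J (l (Suc n)) \<le> J (l n) - \<kappa> * N"
    using descent by linarith
  then have old: "real n * (J (l (Suc n)) - J m) \<le> real n * (J (l n) - J m - \<kappa> * N)"
    by (intro mult_left_mono) auto
  have dist: "(norm (l (Suc n) - m))\<^sup>2 / (2 * \<gamma>)
      = (norm (l n - m))\<^sup>2 / (2 * \<gamma>) - inner g (l n - m) + \<gamma> * N / 2"
  proof -
    have "(norm (l (Suc n) - m))\<^sup>2 = (norm (l n - m))\<^sup>2 - 2 * \<gamma> * inner g (l n - m) + \<gamma>\<^sup>2 * N"
      unfolding step g_def[symmetric] N_def power2_norm_eq_inner
      by (simp add: inner_diff_left inner_diff_right inner_commute power2_eq_square algebra_simps)
    then show ?thesis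
      using \<open>0 < \<gamma>\<close> by (simp add: field_simps power2_eq_square)
  qed
  have "J (l n) - J m \<le> inner g (l n - m)"
    using convex[of "l n" m] by (simp add: g_def inner_diff_right)
  then have new: "J (l (Suc n)) - J m + (norm (l (Suc n) - m))\<^sup>2 / (2 * \<gamma>)
      \<le> (norm (l n - m))\<^sup>2 / (2 * \<gamma>) - \<kappa> * N / 2"
  proof -
    have "(\<gamma> - \<gamma>\<^sup>2 * L / 2) * N = \<gamma> * N / 2 + \<kappa> * N / 2"
      by (simp add: \<kappa>_def power2_eq_square field_simps)
    with \<open>J (l n) - J m \<le> inner g (l n - m)\<close> descent dist show ?thesis
      by linarith
  qed
  have "\<rho> \<le> N"
    using Suc.prems[of n] by (simp add: N_def g_def)
  then have "\<kappa> * (real n + 1/2) * \<rho> \<le> \<kappa> * (real n + 1/2) * N"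
    using \<open>0 \<le> \<kappa>\<close> by (intro mult_left_mono) auto
  moreover have "\<rho> * \<gamma> * (1 - \<gamma> * L) / 2 * (real (Suc n))\<^sup>2
      = \<rho> * \<gamma> * (1 - \<gamma> * L) / 2 * (real n)\<^sup>2 + \<kappa> * (real n + 1/2) * \<rho>"
    by (simp add: \<kappa>_def power2_eq_square field_simps)
  moreover have "real (Suc n) * (J (l (Suc n)) - J m)
      = real n * (J (l (Suc n)) - J m) + (J (l (Suc n)) - J m)"
    by (simp add: algebra_simps)
  moreover have "real n * (J (l n) - J m - \<kappa> * N) = real n * (J (l n) - J m) - real n * (\<kappa> * N)"
    by (simp add: algebra_simps)
  moreover have "\<kappa> * (real n + 1/2) * N = real n * (\<kappa> * N) + \<kappa> * N / 2"
    by (simp add: algebra_simps)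
  moreover have "real n * (J (l n) - J m) + (norm (l n - m))\<^sup>2 / (2 * \<gamma>)
      + \<rho> * \<gamma> * (1 - \<gamma> * L) / 2 * (real n)\<^sup>2 \<le> (norm (l 0 - m))\<^sup>2 / (2 * \<gamma>)"
    using Suc.IH Suc.prems by simp
  ultimately show ?case
    using old new by linarith
qed

section \<open>The duality gap of the constrained problem\<close>

locale constrained_problem =
  fixes A :: "'a::{real_inner, complete_space} \<Rightarrow> 'b::{real_inner, complete_space}"
    and C :: "'a set" and y :: 'b
  assumes bounded_linear: "bounded_linear A"
    and closed: "closed C" and convex: "convex C"
    and feasible: "\<exists>x\<in>C. A x = y"
begin

lemma nonempty: "C \<noteq> {}"
  using feasible by auto

lemma linear: "linear A"
  using bounded_linear by (rule bounded_linear.linear)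

abbreviation xdag :: 'a where
  "xdag \<equiv> min_norm_solution A C y"

lemma min_norm_solution_properties:
  shows min_norm_in: "xdag \<in> C" and min_norm_solves: "A xdag = y"
    and min_norm_unique: "\<And>x. x \<in> C \<Longrightarrow> A x = y \<Longrightarrow> norm x \<le> norm xdag \<Longrightarrow> x = xdag"
proof -
  define S where "S = C \<inter> {x. A x = y}"
  have "closed S"
    unfolding S_def
    by (intro closed_Int closed closed_Collect_eq continuous_intros
        linear_continuous_on[OF bounded_linear])
  moreover have "convex S"
    unfolding S_def
  proof (rule convex_Int[OF convex])
    show "convex {x. A x = y}"
      unfolding convex_def
      by (auto simp: linear_add[OF linear] linear_scale[OF linear] simp flip: scaleR_add_left)
  qed
  moreover have "S \<noteq> {}"
    using feasible by (auto simp: S_def)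
  ultimately have S: "closed S" "convex S" "S \<noteq> {}" .
  define p where "p = metric_proj S 0"
  have p: "p \<in> S" "\<And>w. w \<in> S \<Longrightarrow> norm p \<le> norm w"
    unfolding p_def using metric_proj_in[OF S] metric_proj_dist_le[OF S, of _ 0] by auto
  have uniq: "w = p" if "w \<in> S" "norm w \<le> norm p" for w
  proof (rule any_closest_point_unique[OF S(2,1) that(1) p(1), of 0])
    show "\<forall>z\<in>S. dist 0 w \<le> dist 0 z" "\<forall>z\<in>S. dist 0 p \<le> dist 0 z"
      using p(2) that(2) by (auto intro: order_trans)
  qed
  have "xdag = p"
    unfolding min_norm_solution_def
  proof (rule the_equality)
    show "is_arg_min (\<lambda>x. 1/2 * (norm x)\<^sup>2) (\<lambda>x. x \<in> C \<and> A x = y) p"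
      unfolding is_arg_min_linorder using p by (auto simp: S_def power_mono)
  next
    fix w assume "is_arg_min (\<lambda>x. 1/2 * (norm x)\<^sup>2) (\<lambda>x. x \<in> C \<and> A x = y) w"
    then have "w \<in> S" "(norm w)\<^sup>2 \<le> (norm p)\<^sup>2"
      unfolding is_arg_min_linorder using p(1) by (auto simp: S_def)
    then show "w = p"
      using uniq power2_le_imp_le[of "norm w" "norm p"] by simp
  qed
  then show "xdag \<in> C" "A xdag = y" "\<And>x. x \<in> C \<Longrightarrow> A x = y \<Longrightarrow> norm x \<le> norm xdag \<Longrightarrow> x = xdag"
    using p(1) uniq by (auto simp: S_def)
qed

definition primal :: "'b \<Rightarrow> 'a" where
  "primal l = metric_proj C (adjoint A l)"

definition dual :: "'b \<Rightarrow> 'b \<Rightarrow> real" where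
  "dual z l = energy_conj C (adjoint A l) - inner l z"

text \<open>The value of the dual functional for exact data minus its infimum, which is
  \<open>- \<parallel>xdag\<parallel>\<^sup>2 / 2\<close>.\<close>

definition gap :: "'b \<Rightarrow> real" where
  "gap l = dual y l + (norm xdag)\<^sup>2 / 2"

lemma dual_convex: "dual z l + inner (A (primal l) - z) (m - l) \<le> dual z m"
proof -
  have "inner (primal l) (adjoint A m - adjoint A l) = inner (A (primal l)) (m - l)"
    by (simp add: inner_diff_right adjoint_inner[OF bounded_linear])
  then show ?thesis
    using energy_conj_convex[OF closed convex nonempty, of "adjoint A l" "adjoint A m"]
    by (simp add: dual_def primal_def inner_diff_left inner_diff_right inner_commute)
qed

lemma dual_smooth:
  "dual z m \<le> dual z l + inner (A (primal l) - z) (m - l) + (onorm A)\<^sup>2 / 2 * (norm (m - l))\<^sup>2"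
proof -
  have "adjoint A m - adjoint A l = adjoint A (m - l)"
    using adjoint_bounded_linear[OF bounded_linear]
    by (simp add: linear_diff bounded_linear.linear)
  then have "(norm (adjoint A m - adjoint A l))\<^sup>2 \<le> (onorm A * norm (m - l))\<^sup>2"
    using adjoint_norm_le[OF bounded_linear] by (intro power_mono) auto
  moreover have "inner (primal l) (adjoint A m - adjoint A l) = inner (A (primal l)) (m - l)"
    by (simp add: inner_diff_right adjoint_inner[OF bounded_linear])
  ultimately show ?thesis
    using energy_conj_smooth[OF closed convex nonempty, of "adjoint A m" "adjoint A l"]
    by (simp add: dual_def primal_def inner_diff_left inner_diff_right inner_commute power_mult_distrib)
qed

lemma error_le_gap: "(norm (primal l - xdag))\<^sup>2 / 2 \<le> gap l"
proof -
  have "inner (adjoint A l) xdag = inner l y"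
    by (metis adjoint_inner[OF bounded_linear] inner_commute min_norm_solves)
  then show ?thesis
    using energy_conj_strong_max[OF closed convex min_norm_in, of "adjoint A l"]
    by (simp add: gap_def dual_def primal_def norm_minus_commute)
qed

lemma gap_nonneg: "0 \<le> gap l"
  using error_le_gap[of l] zero_le_power2[of "norm (primal l - xdag)"] by linarith

lemma gap_le_residual: "gap l \<le> gap m + norm (A (primal l) - y) * norm (l - m)"
proof -
  have "inner (A (primal l) - y) (l - m) \<le> norm (A (primal l) - y) * norm (l - m)"
    by (rule norm_cauchy_schwarz)
  then show ?thesis
    using dual_convex[of y l m] by (simp add: gap_def inner_diff_right)
qed

text \<open>As a function of \<open>A\<^sup>*l\<close>, the gap extends to all of the primal space; under the assumption its extension
  vanishes at \<open>\<xi>\<close> together with its gradient, so smoothness bounds it by a square.\<close>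

lemma gap_le_source:
  assumes "xdag = metric_proj C \<xi>"
  shows "gap l \<le> (norm (adjoint A l - \<xi>))\<^sup>2 / 2"
proof -
  have "inner (adjoint A l) xdag = inner l y"
    by (metis adjoint_inner[OF bounded_linear] inner_commute min_norm_solves)
  then show ?thesis
    using energy_conj_smooth[OF closed convex nonempty, of "adjoint A l" \<xi>]
    unfolding energy_conj_def[of C \<xi>] assms[symmetric]
    by (simp add: gap_def dual_def inner_diff_right inner_commute)
qed

text \<open>Strong duality: the minimisers \<open>x k\<close> of the penalised functionals
  \<open>\<parallel>x\<parallel>\<^sup>2 + k\<^sup>2 \<parallel>A x - y\<parallel>\<^sup>2\<close> over \<open>C\<close> converge to \<open>xdag\<close> and have the form \<open>primal l\<close> with
  \<open>l = k\<^sup>2 (y - A (x k))\<close>, whose gap is at most \<open>(\<parallel>xdag\<parallel>\<^sup>2 - \<parallel>x k\<parallel>\<^sup>2) / 2\<close>. The penalised functional is the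
  squared norm on the graph of \<open>x \<mapsto> k (A x - y)\<close> over \<open>C\<close>, so its minimiser comes from the projection
  of the origin onto this closed convex subset of the product space.\<close>

lemma gap_arbitrarily_small:
  assumes "0 < e"
  shows "\<exists>l. gap l < e"
proof -
  \<comment> \<open>The penalty parameters start at 1, so that dividing by them is possible.\<close>
  define c where "c k = real (Suc k)" for k
  define K where "K k = fst -` C \<inter> {p. snd p = c k *\<^sub>R (A (fst p) - y)}" for k
  have inK: "(x, c k *\<^sub>R (A x - y)) \<in> K k" if "x \<in> C" for x k
    using that by (simp add: K_def)
  have Kcl: "closed (K k)" for k
    unfolding K_def
    by (intro closed_Int closed_vimage closed closed_Collect_eq continuous_intros
        bounded_linear.continuous_on[OF bounded_linear])
  have Kcv: "convex (K k)" for k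
  proof (rule convexI)
    fix p q :: "'a \<times> 'b" and u v :: real
    assume pq: "p \<in> K k" "q \<in> K k" and uv: "0 \<le> u" "0 \<le> v" "u + v = 1"
    have "u *\<^sub>R fst p + v *\<^sub>R fst q \<in> C"
      using convexD[OF convex, of "fst p" "fst q" u v] pq uv by (simp add: K_def)
    moreover have "u *\<^sub>R snd p + v *\<^sub>R snd q = c k *\<^sub>R (A (u *\<^sub>R fst p + v *\<^sub>R fst q) - y)"
    proof -
      have "A (u *\<^sub>R fst p + v *\<^sub>R fst q) - y
          = (u *\<^sub>R A (fst p) + v *\<^sub>R A (fst q)) - (u + v) *\<^sub>R y"
        using uv(3) by (simp add: linear_add[OF linear] linear_scale[OF linear])
      also have "\<dots> = u *\<^sub>R (A (fst p) - y) + v *\<^sub>R (A (fst q) - y)"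
        by (simp add: scaleR_add_left scaleR_diff_right)
      finally have "A (u *\<^sub>R fst p + v *\<^sub>R fst q) - y
          = u *\<^sub>R (A (fst p) - y) + v *\<^sub>R (A (fst q) - y)" .
      moreover have "snd p = c k *\<^sub>R (A (fst p) - y)" "snd q = c k *\<^sub>R (A (fst q) - y)"
        using pq by (auto simp: K_def)
      ultimately show ?thesis
        by (simp add: scaleR_add_right mult.commute)
    qed
    ultimately show "u *\<^sub>R p + v *\<^sub>R q \<in> K k"
      by (simp add: K_def)
  qed
  have Kne: "K k \<noteq> {}" for k
    using inK[OF min_norm_in] by blast
  define w where "w k = metric_proj (K k) 0" for k
  define x where "x k = fst (w k)" for k
  have w: "w k \<in> K k" for k
    unfolding w_def by (rule metric_proj_in[OF Kcl Kcv Kne])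
  then have xC: "x k \<in> C" and w_eq: "w k = (x k, c k *\<^sub>R (A (x k) - y))" for k
    by (auto simp: K_def x_def prod_eq_iff)
  have dot: "0 \<le> inner (w k) (p - w k)" if "p \<in> K k" for p k
    using metric_proj_dot[OF Kcl Kcv Kne that, of 0] by (simp add: w_def)
  have pyth: "(norm (w k))\<^sup>2 + (norm (p - w k))\<^sup>2 \<le> (norm p)\<^sup>2" if "p \<in> K k" for p k
    using dot[OF that] unfolding power2_norm_eq_inner
    by (simp add: inner_diff_left inner_diff_right inner_commute)

  have w_le: "norm (w k) \<le> norm xdag" for k
  proof -
    have "(norm (w k))\<^sup>2 + (norm ((xdag, 0) - w k))\<^sup>2 \<le> (norm xdag)\<^sup>2"
      using pyth[OF inK[OF min_norm_in]] by (simp add: min_norm_solves)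
    then have "(norm (w k))\<^sup>2 \<le> (norm xdag)\<^sup>2"
      using zero_le_power2[of "norm ((xdag, 0) - w k)"] by linarith
    then show ?thesis
      by (rule power2_le_imp_le) simp
  qed
  have mono: "(norm (w k))\<^sup>2 + (norm (x j - x k))\<^sup>2 \<le> (norm (w j))\<^sup>2" if "k \<le> j" for j k
  proof -
    let ?p = "(x j, c k *\<^sub>R (A (x j) - y))"
    have "(norm ?p)\<^sup>2 \<le> (norm (w j))\<^sup>2"
      unfolding w_eq[of j] norm_Pair using that by (auto simp: c_def power_mult_distrib
          intro!: mult_right_mono)
    moreover have "(norm (x j - x k))\<^sup>2 \<le> (norm (?p - w k))\<^sup>2"
      unfolding w_eq[of k] by (simp add: norm_Pair)
    ultimately show ?thesis
      using pyth[OF inK[OF xC[of j]], of k] by linarith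
  qed
  have "incseq (\<lambda>k. (norm (w k))\<^sup>2)"
  proof (rule monoI)
    fix k j :: nat assume "k \<le> j"
    then show "(norm (w k))\<^sup>2 \<le> (norm (w j))\<^sup>2"
      using mono[of k j] zero_le_power2[of "norm (x j - x k)"] by linarith
  qed
  moreover have "(norm (w k))\<^sup>2 \<le> (norm xdag)\<^sup>2" for k
    using w_le by (simp add: power_mono)
  ultimately obtain N where N: "(\<lambda>k. (norm (w k))\<^sup>2) \<longlonglongrightarrow> N" "\<And>k. (norm (w k))\<^sup>2 \<le> N"
    using incseq_convergent[of "\<lambda>k. (norm (w k))\<^sup>2" "(norm xdag)\<^sup>2"] by blast
  have "Cauchy x"
  proof (rule CauchyI')
    fix r :: real assume "r > 0"
    then have "\<forall>\<^sub>F k in sequentially. N - r\<^sup>2 < (norm (w k))\<^sup>2"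
      using order_tendstoD(1)[OF N(1), of "N - r\<^sup>2"] by simp
    then obtain M where M: "\<And>k. k \<ge> M \<Longrightarrow> N - r\<^sup>2 < (norm (w k))\<^sup>2"
      unfolding eventually_sequentially by auto
    have "dist (x k) (x j) < r" if "M \<le> k" "k < j" for k j
    proof (rule power_less_imp_less_base)
      show "(dist (x k) (x j))\<^sup>2 < r\<^sup>2"
        using mono[of k j] N(2)[of j] M[of k] that by (simp add: dist_norm norm_minus_commute)
    qed (use \<open>r > 0\<close> in simp)
    then show "\<exists>M. \<forall>k\<ge>M. \<forall>j>k. dist (x k) (x j) < r"
      by blast
  qed
  then obtain x' where x': "x \<longlonglongrightarrow> x'"
    using Cauchy_convergent convergent_def by blast
  have "x' \<in> C"
    using closed_sequentially[OF closed _ x'] xC by blast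
  moreover have "A x' = y"
  proof -
    have bound: "norm (A (x k) - y) \<le> norm xdag * inverse (real (Suc k))" for k
    proof -
      have "c k * norm (A (x k) - y) \<le> norm (w k)"
        using norm_snd_le[of "c k *\<^sub>R (A (x k) - y)" "x k"] by (simp add: w_eq c_def)
      also have "\<dots> \<le> norm xdag"
        by (rule w_le)
      finally show ?thesis
        by (simp add: c_def field_simps)
    qed
    have "(\<lambda>k. norm xdag * inverse (real (Suc k))) \<longlonglongrightarrow> 0"
      using tendsto_mult_left[OF LIMSEQ_inverse_real_of_nat, of "norm xdag"] by simp
    then have "(\<lambda>k. A (x k) - y) \<longlonglongrightarrow> 0"
      by (rule Lim_null_comparison[rotated]) (intro always_eventually allI bound)
    then have "(\<lambda>k. A (x k)) \<longlonglongrightarrow> y"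
      by (simp add: LIM_zero_iff)
    moreover have "(\<lambda>k. A (x k)) \<longlonglongrightarrow> A x'"
      using bounded_linear.tendsto[OF bounded_linear x'] .
    ultimately show ?thesis
      by (rule LIMSEQ_unique[rotated])
  qed
  moreover have "norm x' \<le> norm xdag"
  proof (rule LIMSEQ_le_const2)
    show "(\<lambda>k. norm (x k)) \<longlonglongrightarrow> norm x'"
      using x' by (rule tendsto_norm)
    have "norm (x k) \<le> norm xdag" for k
      using norm_fst_le[of "x k" "c k *\<^sub>R (A (x k) - y)"] w_le[of k] by (simp add: w_eq)
    then show "\<exists>N. \<forall>k\<ge>N. norm (x k) \<le> norm xdag"
      by blast
  qed
  ultimately have "x' = xdag"
    by (rule min_norm_unique)
  then have "(\<lambda>k. ((norm xdag)\<^sup>2 - (norm (x k))\<^sup>2) / 2) \<longlonglongrightarrow> ((norm xdag)\<^sup>2 - (norm xdag)\<^sup>2) / 2"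
    using x' by (intro tendsto_intros) auto
  then have "\<forall>\<^sub>F k in sequentially. ((norm xdag)\<^sup>2 - (norm (x k))\<^sup>2) / 2 < e"
    by (rule order_tendstoD(2)) (use \<open>0 < e\<close> in simp)
  then obtain k where k: "((norm xdag)\<^sup>2 - (norm (x k))\<^sup>2) / 2 < e"
    unfolding eventually_sequentially by auto

  define l where "l = (c k)\<^sup>2 *\<^sub>R (y - A (x k))"
  have "metric_proj C (adjoint A l) = x k"
  proof (rule metric_proj_eqI[OF closed convex xC])
    fix v assume "v \<in> C"
    have "inner (adjoint A l) (v - x k) = inner l (A v - A (x k))"
      by (metis adjoint_inner[OF bounded_linear] inner_commute linear_diff[OF linear])
    moreover have "0 \<le> inner (x k) (v - x k) - inner l (A v - A (x k))"
      using dot[OF inK[OF \<open>v \<in> C\<close>]]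
      by (simp add: w_eq l_def power2_eq_square inner_diff_left inner_diff_right algebra_simps)
    ultimately show "inner (adjoint A l - x k) (v - x k) \<le> 0"
      by (simp add: inner_diff_left)
  qed
  moreover have "inner (adjoint A l) (x k) = inner l (A (x k))"
    by (metis adjoint_inner[OF bounded_linear] inner_commute)
  ultimately have "gap l = ((norm xdag)\<^sup>2 - (norm (x k))\<^sup>2) / 2 + inner l (A (x k) - y)"
    by (simp add: gap_def dual_def energy_conj_def inner_diff_right field_simps)
  moreover have "inner l (A (x k) - y) \<le> 0"
  proof -
    have "inner l (A (x k) - y) = - ((c k)\<^sup>2 * (norm (A (x k) - y))\<^sup>2)"
      unfolding l_def power2_norm_eq_inner
      by (simp add: inner_diff_left inner_diff_right inner_commute algebra_simps)
    then show ?thesis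
      by simp
  qed
  ultimately show ?thesis
    using k by (intro exI[of _ l]) linarith
qed

section \<open>Error estimates for the Landweber iteration\<close>

lemma gap_diff_eq: "gap l - gap m = dual z l - dual z m + inner (l - m) (z - y)"
  by (simp add: gap_def dual_def inner_diff_left inner_diff_right)

lemma landweber_iter_eq_primal: "landweber_iter A C \<gamma> yd n = primal (landweber_dual A C \<gamma> yd n)"
  by (simp add: landweber_iter_def primal_def)

text \<open>The iteration is gradient descent for the dual functional with datum \<open>yd\<close>. Passing from it to the gap,
  which belongs to the exact datum, costs the term with \<open>\<delta>\<close>.\<close>

lemma landweber_gap_estimate:
  assumes "0 < \<gamma>" "\<gamma> * (onorm A)\<^sup>2 \<le> 1" "norm (yd - y) \<le> \<delta>"
    and res: "\<And>k. k < n \<Longrightarrow> \<rho> \<le> (norm (A (landweber_iter A C \<gamma> yd k) - yd))\<^sup>2"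
    and l: "l = landweber_dual A C \<gamma> yd n"
  shows "real n * (gap l - gap m) + (norm (l - m))\<^sup>2 / (2 * \<gamma>)
      + \<rho> * \<gamma> * (1 - \<gamma> * (onorm A)\<^sup>2) / 2 * (real n)\<^sup>2
    \<le> (norm m)\<^sup>2 / (2 * \<gamma>) + real n * \<delta> * norm (l - m)"
proof -
  have "real n * (dual yd l - dual yd m) + (norm (l - m))\<^sup>2 / (2 * \<gamma>)
      + \<rho> * \<gamma> * (1 - \<gamma> * (onorm A)\<^sup>2) / 2 * (real n)\<^sup>2
    \<le> (norm (landweber_dual A C \<gamma> yd 0 - m))\<^sup>2 / (2 * \<gamma>)"
    unfolding l
    by (rule gradient_descent_estimate[where G = "\<lambda>l. A (primal l) - yd"])
      (use assms(1,2) res dual_convex dual_smooth in \<open>simp_all add: primal_def landweber_iter_def\<close>)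
  moreover have "real n * inner (l - m) (yd - y) \<le> real n * \<delta> * norm (l - m)"
  proof -
    have "inner (l - m) (yd - y) \<le> norm (l - m) * norm (yd - y)"
      by (rule norm_cauchy_schwarz)
    also have "\<dots> \<le> norm (l - m) * \<delta>"
      using assms(3) by (rule mult_left_mono) simp
    finally have "real n * inner (l - m) (yd - y) \<le> real n * (norm (l - m) * \<delta>)"
      by (rule mult_left_mono) simp
    then show ?thesis
      by (simp add: mult_ac)
  qed
  moreover have "real n * (gap l - gap m)
      = real n * (dual yd l - dual yd m) + real n * inner (l - m) (yd - y)"
    unfolding gap_diff_eq[of l m yd] by (simp add: distrib_left)
  ultimately show ?thesis
    by simp
qed

lemma gap_landweber_le:
  assumes "0 < \<gamma>" "\<gamma> * (onorm A)\<^sup>2 \<le> 1" "norm (yd - y) \<le> \<delta>" "0 < n"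
  shows "gap (landweber_dual A C \<gamma> yd n)
    \<le> gap m + (norm m)\<^sup>2 / (2 * \<gamma> * real n) + \<gamma> / 2 * (\<delta>\<^sup>2 * real n)"
proof -
  let ?l = "landweber_dual A C \<gamma> yd n"
  have "real n * (gap ?l - gap m) + (norm (?l - m))\<^sup>2 / (2 * \<gamma>)
      \<le> (norm m)\<^sup>2 / (2 * \<gamma>) + real n * \<delta> * norm (?l - m)"
    using landweber_gap_estimate[OF assms(1-3), of n 0 ?l m] by simp
  then have "real n * (gap ?l - gap m) \<le> (norm m)\<^sup>2 / (2 * \<gamma>) + \<gamma> * (real n * \<delta>)\<^sup>2 / 2"
    using mult_le_weighted_squares[OF assms(1), of "real n * \<delta>" "norm (?l - m)"] by linarith
  also have "\<dots> = real n * ((norm m)\<^sup>2 / (2 * \<gamma> * real n) + \<gamma> / 2 * (\<delta>\<^sup>2 * real n))"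
    using \<open>0 < n\<close> \<open>0 < \<gamma>\<close> by (simp add: power2_eq_square field_simps)
  finally have "gap ?l - gap m \<le> (norm m)\<^sup>2 / (2 * \<gamma> * real n) + \<gamma> / 2 * (\<delta>\<^sup>2 * real n)"
    using \<open>0 < n\<close> by simp
  then show ?thesis
    by simp
qed

text \<open>As long as the discrepancy exceeds \<open>\<tau> \<delta>\<close>, the decrease of the dual functional outweighs the
  amplified noise \<open>\<gamma> n \<delta>\<^sup>2 / 2\<close>, because \<open>\<tau>\<^sup>2 (1 - \<gamma> \<parallel>A\<parallel>\<^sup>2) > \<tau> > 1\<close>. The case
  \<open>m = 0\<close> shows that there are finitely many such steps.\<close>

lemma steps_before_stopping_le:
  assumes "0 < \<gamma>" "1 < \<tau>" "0 < 1 - 1 / \<tau> - (onorm A)\<^sup>2 * \<gamma>" "norm (yd - y) \<le> \<delta>"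
    and res: "\<And>k. k < n \<Longrightarrow> \<tau> * \<delta> < norm (A (landweber_iter A C \<gamma> yd k) - yd)"
  shows "\<gamma> * (\<tau> - 1) / 2 * (real n * \<delta>)\<^sup>2 \<le> real n * gap m + (norm m)\<^sup>2 / (2 * \<gamma>)"
proof -
  let ?l = "landweber_dual A C \<gamma> yd n"
  define \<kappa> where "\<kappa> = 1 - \<gamma> * (onorm A)\<^sup>2"
  have "0 \<le> \<delta>"
    using assms(4) norm_ge_zero order_trans by blast
  have "0 < 1 / \<tau>"
    using \<open>1 < \<tau>\<close> by simp
  have "1 / \<tau> < \<kappa>"
    using assms(3) by (simp add: \<kappa>_def mult.commute)
  then have "\<gamma> * (onorm A)\<^sup>2 \<le> 1"
    using \<open>0 < 1 / \<tau>\<close> unfolding \<kappa>_def by linarith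
  have "(\<tau> * \<delta>)\<^sup>2 \<le> (norm (A (landweber_iter A C \<gamma> yd k) - yd))\<^sup>2" if "k < n" for k
    using res[OF that] \<open>0 \<le> \<delta>\<close> \<open>1 < \<tau>\<close> by (intro power_mono) auto
  from landweber_gap_estimate[OF assms(1) \<open>\<gamma> * (onorm A)\<^sup>2 \<le> 1\<close> assms(4) this refl, of n m]
  have "real n * (gap ?l - gap m) + (\<tau> * \<delta>)\<^sup>2 * \<gamma> * \<kappa> / 2 * (real n)\<^sup>2
      \<le> (norm m)\<^sup>2 / (2 * \<gamma>) + \<gamma> * (real n * \<delta>)\<^sup>2 / 2"
    using mult_le_weighted_squares[OF assms(1), of "real n * \<delta>" "norm (?l - m)"] unfolding \<kappa>_def by linarith
  moreover have "\<tau> * (\<gamma> * (real n * \<delta>)\<^sup>2 / 2) \<le> (\<tau> * \<delta>)\<^sup>2 * \<gamma> * \<kappa> / 2 * (real n)\<^sup>2"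
  proof -
    have "\<tau> * 1 \<le> \<tau> * (\<tau> * \<kappa>)"
      using \<open>1 / \<tau> < \<kappa>\<close> \<open>1 < \<tau>\<close> by (intro mult_left_mono) (auto simp: field_simps)
    then have "\<tau> * (\<gamma> * (real n * \<delta>)\<^sup>2 / 2) \<le> \<tau> * (\<tau> * \<kappa>) * (\<gamma> * (real n * \<delta>)\<^sup>2 / 2)"
      using \<open>0 < \<gamma>\<close> by (intro mult_right_mono) auto
    also have "\<dots> = (\<tau> * \<delta>)\<^sup>2 * \<gamma> * \<kappa> / 2 * (real n)\<^sup>2"
      by (simp add: power2_eq_square)
    finally show ?thesis .
  qed
  moreover have "0 \<le> real n * gap ?l"
    using gap_nonneg by simp
  ultimately show ?thesis
    by (simp add: algebra_simps diff_divide_distrib)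
qed

lemma discrepancy_index_unique_exists:
  assumes "0 < \<gamma>" "1 < \<tau>" "0 < 1 - 1 / \<tau> - (onorm A)\<^sup>2 * \<gamma>" "norm (yd - y) \<le> \<delta>" "0 < \<delta>"
  shows "\<exists>!n. discrepancy_index A C \<gamma> \<tau> \<delta> yd n"
proof -
  define P where "P n \<longleftrightarrow> norm (A (landweber_iter A C \<gamma> yd n) - yd) \<le> \<tau> * \<delta>" for n
  have "\<exists>n. P n"
  proof (rule ccontr)
    assume "\<not> ?thesis"
    then have res: "\<tau> * \<delta> < norm (A (landweber_iter A C \<gamma> yd k) - yd)" for k
      by (auto simp: P_def not_le)
    define a where "a = \<gamma> * (\<tau> - 1) / 2 * \<delta>\<^sup>2"
    have "0 < a"
      using assms by (simp add: a_def)
    obtain n where n: "gap 0 < real n * a"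
      using ex_less_of_nat_mult[OF \<open>0 < a\<close>] by blast
    have "real n \<noteq> 0"
      using n gap_nonneg[of 0] by (cases "n = 0") auto
    have "\<gamma> * (\<tau> - 1) / 2 * (real n * \<delta>)\<^sup>2 \<le> real n * gap 0"
      using steps_before_stopping_le[OF assms(1-4), of n 0] res by simp
    then have "real n * (real n * a) \<le> real n * gap 0"
      by (simp add: a_def power2_eq_square mult_ac)
    then show False
      using n \<open>real n \<noteq> 0\<close> by (simp add: mult_le_cancel_left)
  qed
  then have "P (LEAST n. P n)"
    by (rule LeastI_ex)
  moreover have "\<not> P k" if "k < (LEAST n. P n)" for k
    using that by (rule not_less_Least)
  ultimately have "discrepancy_index A C \<gamma> \<tau> \<delta> yd (LEAST n. P n)"
    by (auto simp: discrepancy_index_def P_def not_le)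
  moreover have "n = k" if "discrepancy_index A C \<gamma> \<tau> \<delta> yd n" "discrepancy_index A C \<gamma> \<tau> \<delta> yd k" for n k
    using that unfolding discrepancy_index_def by (meson linorder_neqE_nat not_le)
  ultimately show ?thesis
    by blast
qed

text \<open>The step count bound gives \<open>n \<delta>\<^sup>2 = O(gap m + \<delta> \<parallel>m\<parallel>)\<close>, which turns the noise estimate into the
  same bound for \<open>\<delta> \<parallel>l - m\<parallel>\<close>, where \<open>l\<close> is the dual iterate. As the residual at the stopping index is
  at most \<open>(\<tau> + 1) \<delta>\<close>, convexity compares the gaps at \<open>l\<close> and \<open>m\<close>.\<close>

lemma gap_discrepancy_le:
  assumes "0 < \<gamma>" "1 < \<tau>" "0 < 1 - 1 / \<tau> - (onorm A)\<^sup>2 * \<gamma>"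
  obtains K where "0 < K"
    "\<And>\<delta> yd n m. 0 < \<delta> \<Longrightarrow> norm (yd - y) \<le> \<delta> \<Longrightarrow> discrepancy_index A C \<gamma> \<tau> \<delta> yd n \<Longrightarrow>
      gap (landweber_dual A C \<gamma> yd n) \<le> K * (gap m + \<delta> * norm m)"
proof -
  define \<kappa> where "\<kappa> = \<gamma> * (\<tau> - 1) / 2"
  have "0 < \<kappa>"
    using assms by (simp add: \<kappa>_def)
  define K1 where "K1 = 1 / \<kappa> + sqrt (1 / (2 * \<gamma> * \<kappa>))"
  define K2 where "K2 = 2 * \<gamma> * K1 + sqrt (2 * \<gamma> * K1 + 1)"
  define K where "K = 1 + (\<tau> + 1) * K2"
  have "0 \<le> K1"
    using \<open>0 < \<kappa>\<close> \<open>0 < \<gamma>\<close> by (simp add: K1_def)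
  then have "0 \<le> K2"
    using \<open>0 < \<gamma>\<close> by (simp add: K2_def)
  then have "0 < K"
    using \<open>1 < \<tau>\<close> by (simp add: K_def add_pos_nonneg)
  moreover have "gap (landweber_dual A C \<gamma> yd n) \<le> K * (gap m + \<delta> * norm m)"
    if \<delta>: "0 < \<delta>" "norm (yd - y) \<le> \<delta>" and n: "discrepancy_index A C \<gamma> \<tau> \<delta> yd n" for \<delta> yd n m
  proof -
    let ?l = "landweber_dual A C \<gamma> yd n"
    define S where "S = gap m + \<delta> * norm m"
    define q where "q = real n * \<delta>\<^sup>2"
    define u where "u = \<delta> * norm (?l - m)"
    have S: "0 \<le> S" "gap m \<le> S" "\<delta> * norm m \<le> S"
      using gap_nonneg[of m] \<delta>(1) by (auto simp: S_def)
    then have S2: "\<delta>\<^sup>2 * (norm m)\<^sup>2 \<le> S\<^sup>2"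
      using power_mono[OF S(3), of 2] \<delta>(1) by (simp add: power_mult_distrib)
    have q: "0 \<le> q" and u: "0 \<le> u"
      using \<delta>(1) by (auto simp: q_def u_def)

    have "\<kappa> * (real n * \<delta>)\<^sup>2 \<le> real n * gap m + (norm m)\<^sup>2 / (2 * \<gamma>)"
      unfolding \<kappa>_def using n
      by (intro steps_before_stopping_le[OF assms \<delta>(2)]) (simp add: discrepancy_index_def)
    then have "\<delta>\<^sup>2 * (\<kappa> * (real n * \<delta>)\<^sup>2) \<le> \<delta>\<^sup>2 * (real n * gap m + (norm m)\<^sup>2 / (2 * \<gamma>))"
      by (intro mult_left_mono) auto
    also have "\<dots> = q * gap m + (\<delta>\<^sup>2 * (norm m)\<^sup>2) / (2 * \<gamma>)"
      by (simp add: q_def algebra_simps)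
    also have "\<dots> \<le> q * S + S\<^sup>2 / (2 * \<gamma>)"
      using S S2 q \<open>0 < \<gamma>\<close> by (intro add_mono mult_left_mono divide_right_mono) auto
    finally have "\<kappa> * q\<^sup>2 \<le> q * S + S\<^sup>2 / (2 * \<gamma>)"
      by (simp add: q_def power2_eq_square mult_ac)
    then have "q\<^sup>2 \<le> S / \<kappa> * q + S\<^sup>2 * (1 / (2 * \<gamma> * \<kappa>))"
      using \<open>0 < \<kappa>\<close> \<open>0 < \<gamma>\<close> by (simp add: field_simps)
    also have "S\<^sup>2 * (1 / (2 * \<gamma> * \<kappa>)) = (S * sqrt (1 / (2 * \<gamma> * \<kappa>)))\<^sup>2"
      using \<open>0 < \<kappa>\<close> \<open>0 < \<gamma>\<close> by (simp add: power_mult_distrib real_sqrt_pow2)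
    finally have "q \<le> S / \<kappa> + S * sqrt (1 / (2 * \<gamma> * \<kappa>))"
      by (rule le_add_if_square_le) (use S(1) \<open>0 < \<kappa>\<close> \<open>0 < \<gamma>\<close> in auto)
    then have q_le: "q \<le> K1 * S"
      by (simp add: K1_def algebra_simps)

    have "0 < 1 / \<tau>"
      using \<open>1 < \<tau>\<close> by simp
    then have "\<gamma> * (onorm A)\<^sup>2 \<le> 1"
      using assms(3) unfolding mult.commute[of \<gamma>] by linarith
    from landweber_gap_estimate[OF assms(1) this \<delta>(2), of n 0 ?l m]
    have "real n * (gap ?l - gap m) + (norm (?l - m))\<^sup>2 / (2 * \<gamma>)
        \<le> (norm m)\<^sup>2 / (2 * \<gamma>) + real n * \<delta> * norm (?l - m)"
      by simp
    moreover have "real n * (gap ?l - gap m) = real n * gap ?l - real n * gap m"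
      by (rule right_diff_distrib)
    moreover have "0 \<le> real n * gap ?l"
      using gap_nonneg by simp
    ultimately have "(norm (?l - m))\<^sup>2 / (2 * \<gamma>)
        \<le> real n * gap m + (norm m)\<^sup>2 / (2 * \<gamma>) + real n * \<delta> * norm (?l - m)"
      by linarith
    then have "(2 * \<gamma> * \<delta>\<^sup>2) * ((norm (?l - m))\<^sup>2 / (2 * \<gamma>)) \<le> (2 * \<gamma> * \<delta>\<^sup>2)
        * (real n * gap m + (norm m)\<^sup>2 / (2 * \<gamma>) + real n * \<delta> * norm (?l - m))"
      using \<open>0 < \<gamma>\<close> by (intro mult_left_mono) auto
    moreover have "(2 * \<gamma> * \<delta>\<^sup>2) * ((norm (?l - m))\<^sup>2 / (2 * \<gamma>)) = u\<^sup>2"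
      using \<open>0 < \<gamma>\<close> by (simp add: u_def power_mult_distrib)
    moreover have "(2 * \<gamma> * \<delta>\<^sup>2)
        * (real n * gap m + (norm m)\<^sup>2 / (2 * \<gamma>) + real n * \<delta> * norm (?l - m))
        = 2 * \<gamma> * (q * gap m) + \<delta>\<^sup>2 * (norm m)\<^sup>2 + 2 * \<gamma> * q * u"
      using \<open>0 < \<gamma>\<close> by (simp add: u_def q_def distrib_left mult_ac)
    ultimately have "u\<^sup>2 \<le> 2 * \<gamma> * (q * gap m) + \<delta>\<^sup>2 * (norm m)\<^sup>2 + 2 * \<gamma> * q * u"
      by simp
    also have "\<dots> \<le> 2 * \<gamma> * (K1 * S * S) + S\<^sup>2 + 2 * \<gamma> * (K1 * S) * u"
      using S S2 q u q_le \<open>0 < \<gamma>\<close> gap_nonneg[of m] by (intro add_mono mult_left_mono mult_right_mono mult_mono) auto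
    also have "\<dots> = (2 * \<gamma> * K1 * S) * u + (S * sqrt (2 * \<gamma> * K1 + 1))\<^sup>2"
      using \<open>0 \<le> K1\<close> \<open>0 < \<gamma>\<close>
      by (simp add: power_mult_distrib real_sqrt_pow2) (simp add: power2_eq_square algebra_simps)
    finally have "u \<le> 2 * \<gamma> * K1 * S + S * sqrt (2 * \<gamma> * K1 + 1)"
      by (rule le_add_if_square_le) (use S(1) \<open>0 \<le> K1\<close> \<open>0 < \<gamma>\<close> in auto)
    then have u_le: "u \<le> K2 * S"
      by (simp add: K2_def algebra_simps)

    have "norm (A (primal ?l) - y) \<le> norm (A (primal ?l) - yd) + norm (yd - y)"
      by (metis diff_add_cancel add_diff_eq norm_triangle_ineq)
    also have "\<dots> \<le> (\<tau> + 1) * \<delta>"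
      using n \<delta>(2) by (simp add: discrepancy_index_def landweber_iter_eq_primal algebra_simps)
    finally have "norm (A (primal ?l) - y) * norm (?l - m) \<le> (\<tau> + 1) * \<delta> * norm (?l - m)"
      by (rule mult_right_mono) simp
    then have "gap ?l \<le> gap m + (\<tau> + 1) * u"
      using gap_le_residual[of ?l m] by (simp add: u_def mult.assoc)
    also have "\<dots> \<le> S + (\<tau> + 1) * (K2 * S)"
      using S(2) u_le \<open>1 < \<tau>\<close> by (intro add_mono mult_left_mono) auto
    finally show ?thesis
      by (simp add: K_def S_def algebra_simps)
  qed
  ultimately show thesis
    by (rule that)
qed

text \<open>This is \<open>frac_power_approx_in_range\<close> with the regularisation parameter
  \<open>\<alpha> = \<delta> powr (2 / (1 + \<nu>))\<close>, which balances the gap at \<open>m\<close> and \<open>\<delta> \<parallel>m\<parallel>\<close>.\<close>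

lemma source_gap_rate:
  assumes "0 < \<nu>" "\<nu> \<le> 1" "projected_source A C \<nu> \<omega> xdag" "0 < \<delta>"
  obtains m where "gap m \<le> 2 * (norm \<omega>)\<^sup>2 * (\<delta> powr (\<nu> / (1 + \<nu>)))\<^sup>2"
    "\<delta> * norm m \<le> 2 * norm \<omega> * (\<delta> powr (\<nu> / (1 + \<nu>)))\<^sup>2"
proof -
  define R where "R = \<delta> powr (\<nu> / (1 + \<nu>))"
  define \<alpha> where "\<alpha> = \<delta> powr (2 / (1 + \<nu>))"
  have "0 < \<alpha>"
    using \<open>0 < \<delta>\<close> by (simp add: \<alpha>_def)
  obtain m where m: "norm (adjoint A m - frac_power (adjoint A \<circ> A) (\<nu> / 2) \<omega>)
      \<le> 2 * \<alpha> powr (\<nu> / 2) * norm \<omega>" "norm m \<le> 2 * \<alpha> powr (\<nu> / 2 - 1/2) * norm \<omega>"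
    using frac_power_approx_in_range[OF bounded_linear, of "\<nu> / 2" \<alpha> \<omega>] \<open>0 < \<alpha>\<close> assms(1,2) by auto
  have R: "\<alpha> powr (\<nu> / 2) = R"
  proof -
    have "2 / (1 + \<nu>) * (\<nu> / 2) = \<nu> / (1 + \<nu>)"
      using \<open>0 < \<nu>\<close> by (simp add: divide_simps)
    then show ?thesis
      unfolding \<alpha>_def R_def powr_powr by simp
  qed
  have R2: "\<delta> * \<alpha> powr (\<nu> / 2 - 1/2) = R\<^sup>2"
  proof -
    have "1 + 2 / (1 + \<nu>) * (\<nu> / 2 - 1/2) = \<nu> / (1 + \<nu>) + \<nu> / (1 + \<nu>)"
    proof -
      have "2 / (1 + \<nu>) * (\<nu> / 2 - 1/2) = (\<nu> - 1) / (1 + \<nu>)"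
        using \<open>0 < \<nu>\<close> by (simp add: divide_simps) (simp add: algebra_simps)
      also have "1 + \<dots> = (\<nu> + \<nu>) / (1 + \<nu>)"
        using \<open>0 < \<nu>\<close> by (simp add: divide_simps)
      finally show ?thesis
        by (simp only: add_divide_distrib)
    qed
    then have "\<delta> powr 1 * \<alpha> powr (\<nu> / 2 - 1/2) = R * R"
      unfolding \<alpha>_def R_def powr_powr powr_add[symmetric] by simp
    then show ?thesis
      using \<open>0 < \<delta>\<close> by (simp add: power2_eq_square)
  qed
  have "gap m \<le> (norm (adjoint A m - frac_power (adjoint A \<circ> A) (\<nu> / 2) \<omega>))\<^sup>2 / 2"
    using assms(3) by (intro gap_le_source) (simp add: projected_source_def)
  also have "\<dots> \<le> (2 * R * norm \<omega>)\<^sup>2 / 2"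
    using m(1) unfolding R by (intro divide_right_mono power_mono) auto
  also have "\<dots> = 2 * (norm \<omega>)\<^sup>2 * R\<^sup>2"
    by (simp add: power_mult_distrib)
  finally have "gap m \<le> 2 * (norm \<omega>)\<^sup>2 * R\<^sup>2" .
  moreover have "\<delta> * norm m \<le> \<delta> * (2 * \<alpha> powr (\<nu> / 2 - 1/2) * norm \<omega>)"
    using m(2) \<open>0 < \<delta>\<close> by (intro mult_left_mono) auto
  then have "\<delta> * norm m \<le> 2 * norm \<omega> * R\<^sup>2"
    unfolding R2[symmetric] by (simp add: mult_ac)
  ultimately show thesis
    using that unfolding R_def by blast
qed

lemma error_le_if_gap_le:
  assumes "gap l \<le> K * R\<^sup>2" "0 \<le> R"
  shows "norm (primal l - xdag) \<le> sqrt (2 * K) * R"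
proof -
  have "(norm (primal l - xdag))\<^sup>2 \<le> 2 * K * R\<^sup>2"
    using error_le_gap[of l] assms(1) by linarith
  then have "norm (primal l - xdag) \<le> sqrt (2 * K * R\<^sup>2)"
    by (rule real_le_rsqrt)
  then show ?thesis
    using \<open>0 \<le> R\<close> by (simp add: real_sqrt_mult)
qed

lemma error_tendsto_if_gap_tendsto:
  assumes "((\<lambda>\<delta>. gap (l \<delta>)) \<longlongrightarrow> 0) F"
  shows "((\<lambda>\<delta>. norm (primal (l \<delta>) - xdag)) \<longlongrightarrow> 0) F"
proof (rule tendsto_sandwich[OF _ _ tendsto_const])
  show "((\<lambda>\<delta>. sqrt (2 * gap (l \<delta>))) \<longlongrightarrow> 0) F"
    using tendsto_real_sqrt[OF tendsto_mult_right_zero[OF assms, of 2]] by simp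
  show "\<forall>\<^sub>F \<delta> in F. norm (primal (l \<delta>) - xdag) \<le> sqrt (2 * gap (l \<delta>))"
    using error_le_gap by (intro always_eventually allI real_le_rsqrt) (simp add: field_simps)
qed simp

lemma landweber_apriori_tendsto:
  fixes yd :: "real \<Rightarrow> 'b" and n :: "real \<Rightarrow> nat"
  assumes "0 < \<gamma>" "\<gamma> * (onorm A)\<^sup>2 \<le> 1" and noise: "\<And>\<delta>. 0 < \<delta> \<Longrightarrow> norm (yd \<delta> - y) \<le> \<delta>"
    and n: "filterlim n at_top (at_right 0)"
    and \<delta>n: "((\<lambda>\<delta>. \<delta>\<^sup>2 * real (n \<delta>)) \<longlongrightarrow> 0) (at_right 0)"
  shows "((\<lambda>\<delta>. norm (landweber_iter A C \<gamma> (yd \<delta>) (n \<delta>) - xdag)) \<longlongrightarrow> 0) (at_right 0)"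
  unfolding landweber_iter_eq_primal
proof (intro error_tendsto_if_gap_tendsto order_tendstoI)
  fix e :: real assume "0 < e"
  obtain m where m: "gap m < e"
    using gap_arbitrarily_small \<open>0 < e\<close> by blast
  have "filterlim (\<lambda>\<delta>. real (n \<delta>)) at_top (at_right 0)"
    using n by (rule filterlim_compose[OF filterlim_real_sequentially])
  then have "((\<lambda>\<delta>. (norm m)\<^sup>2 / (2 * \<gamma>) / real (n \<delta>)) \<longlongrightarrow> 0) (at_right 0)"
    by (intro tendsto_divide_0[OF tendsto_const] filterlim_at_top_imp_at_infinity)
  then have "((\<lambda>\<delta>. gap m + (norm m)\<^sup>2 / (2 * \<gamma>) / real (n \<delta>) + \<gamma> / 2 * (\<delta>\<^sup>2 * real (n \<delta>)))
      \<longlongrightarrow> gap m + 0 + \<gamma> / 2 * 0) (at_right 0)"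
    by (intro tendsto_add tendsto_mult tendsto_const \<delta>n)
  then have "\<forall>\<^sub>F \<delta> in at_right 0. gap m + (norm m)\<^sup>2 / (2 * \<gamma>) / real (n \<delta>) + \<gamma> / 2 * (\<delta>\<^sup>2 * real (n \<delta>)) < e"
    by (rule order_tendstoD(2)) (use m in simp)
  moreover have "\<forall>\<^sub>F \<delta> in at_right 0. 0 < n \<delta>"
    by (rule eventually_compose_filterlim[OF eventually_gt_at_top n])
  moreover have "\<forall>\<^sub>F \<delta> in at_right 0. (0::real) < \<delta>"
    by (rule eventually_at_right_less)
  ultimately show "\<forall>\<^sub>F \<delta> in at_right 0. gap (landweber_dual A C \<gamma> (yd \<delta>) (n \<delta>)) < e"
  proof eventually_elim
    case (elim \<delta>)
    then show ?case
      using gap_landweber_le[OF assms(1,2) noise[OF elim(3)] elim(2), of m] by simp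
  qed
next
  fix e :: real assume "e < 0"
  then show "\<forall>\<^sub>F \<delta> in at_right 0. e < gap (landweber_dual A C \<gamma> (yd \<delta>) (n \<delta>))"
    using gap_nonneg by (intro always_eventually allI) (rule less_le_trans)
qed

lemma landweber_apriori_rate:
  assumes "0 < \<gamma>" "\<gamma> * (onorm A)\<^sup>2 \<le> 1" and \<nu>: "0 < \<nu>" "\<nu> \<le> 1" "projected_source A C \<nu> \<omega> xdag"
    and "0 < c1"
  obtains K where "\<And>\<delta> yd n. 0 < \<delta> \<Longrightarrow> norm (yd - y) \<le> \<delta> \<Longrightarrow>
    c1 * \<delta> powr (- (2 / (1 + \<nu>))) \<le> real n \<Longrightarrow> real n \<le> c2 * \<delta> powr (- (2 / (1 + \<nu>))) \<Longrightarrow>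
    norm (landweber_iter A C \<gamma> yd n - xdag) \<le> K * \<delta> powr (\<nu> / (1 + \<nu>))"
proof -
  define K where "K = 2 * (norm \<omega>)\<^sup>2 + (2 * norm \<omega>)\<^sup>2 / (2 * \<gamma> * c1) + \<gamma> / 2 * c2"
  have "norm (landweber_iter A C \<gamma> yd n - xdag) \<le> sqrt (2 * K) * \<delta> powr (\<nu> / (1 + \<nu>))"
    if \<delta>: "0 < \<delta>" "norm (yd - y) \<le> \<delta>" and n: "c1 * \<delta> powr (- (2 / (1 + \<nu>))) \<le> real n"
      "real n \<le> c2 * \<delta> powr (- (2 / (1 + \<nu>)))" for \<delta> yd n
  proof -
    define R where "R = \<delta> powr (\<nu> / (1 + \<nu>))"
    have "0 < R"
      using \<delta>(1) by (simp add: R_def)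
    have "0 < n"
      using n(1) \<open>0 < c1\<close> \<delta>(1) by (smt (verit) mult_pos_pos of_nat_0_less_iff powr_gt_zero)
    have R2: "\<delta>\<^sup>2 * \<delta> powr (- (2 / (1 + \<nu>))) = R\<^sup>2"
    proof -
      have "2 + - (2 / (1 + \<nu>)) = \<nu> / (1 + \<nu>) + \<nu> / (1 + \<nu>)"
      proof -
        have "2 + - (2 / (1 + \<nu>)) = (2 * (1 + \<nu>) - 2) / (1 + \<nu>)"
          using \<nu>(1) by (simp add: divide_simps)
        also have "\<dots> = (\<nu> + \<nu>) / (1 + \<nu>)"
          by simp
        finally show ?thesis
          by (simp only: add_divide_distrib)
      qed
      then have "\<delta> powr 2 * \<delta> powr (- (2 / (1 + \<nu>))) = R * R"
        unfolding R_def powr_add[symmetric] by simp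
      then show ?thesis
        using \<delta>(1) by (simp add: power2_eq_square)
    qed
    have lower: "c1 * R\<^sup>2 \<le> \<delta>\<^sup>2 * real n" and upper: "\<delta>\<^sup>2 * real n \<le> c2 * R\<^sup>2"
      using mult_left_mono[OF n(1), of "\<delta>\<^sup>2"] mult_left_mono[OF n(2), of "\<delta>\<^sup>2"]
      unfolding R2[symmetric] by (simp_all add: mult_ac)
    obtain m where m: "gap m \<le> 2 * (norm \<omega>)\<^sup>2 * R\<^sup>2" "\<delta> * norm m \<le> 2 * norm \<omega> * R\<^sup>2"
      using source_gap_rate[OF \<nu> \<delta>(1)] unfolding R_def by blast
    have "(norm m)\<^sup>2 / (2 * \<gamma> * real n) = (\<delta> * norm m)\<^sup>2 / (2 * \<gamma> * (\<delta>\<^sup>2 * real n))"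
      using \<delta>(1) by (simp add: power_mult_distrib)
    also have "\<dots> \<le> (2 * norm \<omega> * R\<^sup>2)\<^sup>2 / (2 * \<gamma> * (c1 * R\<^sup>2))"
      using m(2) lower \<open>0 < c1\<close> \<open>0 < R\<close> \<open>0 < \<gamma>\<close> \<delta>(1)
      by (intro frac_le power_mono mult_left_mono) auto
    also have "\<dots> = (2 * norm \<omega>)\<^sup>2 / (2 * \<gamma> * c1) * R\<^sup>2"
      using \<open>0 < R\<close> by (simp add: power2_eq_square)
    finally have "(norm m)\<^sup>2 / (2 * \<gamma> * real n) \<le> (2 * norm \<omega>)\<^sup>2 / (2 * \<gamma> * c1) * R\<^sup>2" .
    moreover have "\<gamma> / 2 * (\<delta>\<^sup>2 * real n) \<le> \<gamma> / 2 * (c2 * R\<^sup>2)"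
      using upper \<open>0 < \<gamma>\<close> by (intro mult_left_mono) auto
    ultimately have "gap (landweber_dual A C \<gamma> yd n) \<le> K * R\<^sup>2"
      using gap_landweber_le[OF assms(1,2) \<delta>(2) \<open>0 < n\<close>, of m] m(1)
      unfolding K_def distrib_right mult.assoc[of "\<gamma> / 2" c2] by linarith
    then show ?thesis
      unfolding landweber_iter_eq_primal R_def[symmetric]
      by (rule error_le_if_gap_le) (use \<open>0 < R\<close> in simp)
  qed
  then show thesis
    by (rule that)
qed

lemma landweber_discrepancy_tendsto:
  fixes yd :: "real \<Rightarrow> 'b" and n :: "real \<Rightarrow> nat"
  assumes "0 < \<gamma>" "1 < \<tau>" "0 < 1 - 1 / \<tau> - (onorm A)\<^sup>2 * \<gamma>"
    and noise: "\<And>\<delta>. 0 < \<delta> \<Longrightarrow> norm (yd \<delta> - y) \<le> \<delta>"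
    and n: "\<And>\<delta>. 0 < \<delta> \<Longrightarrow> discrepancy_index A C \<gamma> \<tau> \<delta> (yd \<delta>) (n \<delta>)"
  shows "((\<lambda>\<delta>. norm (landweber_iter A C \<gamma> (yd \<delta>) (n \<delta>) - xdag)) \<longlongrightarrow> 0) (at_right 0)"
  unfolding landweber_iter_eq_primal
proof (intro error_tendsto_if_gap_tendsto order_tendstoI)
  fix e :: real assume "0 < e"
  obtain K where K: "0 < K"
    "\<And>\<delta> yd n m. 0 < \<delta> \<Longrightarrow> norm (yd - y) \<le> \<delta> \<Longrightarrow> discrepancy_index A C \<gamma> \<tau> \<delta> yd n \<Longrightarrow>
      gap (landweber_dual A C \<gamma> yd n) \<le> K * (gap m + \<delta> * norm m)"
    using gap_discrepancy_le[OF assms(1-3)] by blast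
  obtain m where "gap m < e / K"
    using gap_arbitrarily_small[of "e / K"] \<open>0 < e\<close> \<open>0 < K\<close> by auto
  then have m: "K * (gap m + 0 * norm m) < e"
    using \<open>0 < K\<close> by (simp add: field_simps)
  have "((\<lambda>\<delta>. K * (gap m + \<delta> * norm m)) \<longlongrightarrow> K * (gap m + 0 * norm m)) (at_right 0)"
    by (intro tendsto_intros)
  then have "\<forall>\<^sub>F \<delta> in at_right 0. K * (gap m + \<delta> * norm m) < e"
    using m by (rule order_tendstoD(2))
  moreover have "\<forall>\<^sub>F \<delta> in at_right 0. (0::real) < \<delta>"
    by (rule eventually_at_right_less)
  ultimately show "\<forall>\<^sub>F \<delta> in at_right 0. gap (landweber_dual A C \<gamma> (yd \<delta>) (n \<delta>)) < e"
  proof eventually_elim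
    case (elim \<delta>)
    then show ?case
      using K(2)[OF elim(2) noise[OF elim(2)] n[OF elim(2)], of m] by simp
  qed
next
  fix e :: real assume "e < 0"
  then show "\<forall>\<^sub>F \<delta> in at_right 0. e < gap (landweber_dual A C \<gamma> (yd \<delta>) (n \<delta>))"
    using gap_nonneg by (intro always_eventually allI) (rule less_le_trans)
qed

lemma landweber_discrepancy_rate:
  assumes "0 < \<gamma>" "1 < \<tau>" "0 < 1 - 1 / \<tau> - (onorm A)\<^sup>2 * \<gamma>"
    and \<nu>: "0 < \<nu>" "\<nu> \<le> 1" "projected_source A C \<nu> \<omega> xdag"
  obtains K where "\<And>\<delta> yd n. 0 < \<delta> \<Longrightarrow> norm (yd - y) \<le> \<delta> \<Longrightarrow> discrepancy_index A C \<gamma> \<tau> \<delta> yd n \<Longrightarrow>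
    norm (landweber_iter A C \<gamma> yd n - xdag) \<le> K * \<delta> powr (\<nu> / (1 + \<nu>))"
proof -
  obtain K where K: "0 < K"
    "\<And>\<delta> yd n m. 0 < \<delta> \<Longrightarrow> norm (yd - y) \<le> \<delta> \<Longrightarrow> discrepancy_index A C \<gamma> \<tau> \<delta> yd n \<Longrightarrow>
      gap (landweber_dual A C \<gamma> yd n) \<le> K * (gap m + \<delta> * norm m)"
    using gap_discrepancy_le[OF assms(1-3)] by blast
  define K' where "K' = K * (2 * (norm \<omega>)\<^sup>2 + 2 * norm \<omega>)"
  have "norm (landweber_iter A C \<gamma> yd n - xdag) \<le> sqrt (2 * K') * \<delta> powr (\<nu> / (1 + \<nu>))"
    if \<delta>: "0 < \<delta>" "norm (yd - y) \<le> \<delta>" and n: "discrepancy_index A C \<gamma> \<tau> \<delta> yd n" for \<delta> yd n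
  proof -
    define R where "R = \<delta> powr (\<nu> / (1 + \<nu>))"
    obtain m where m: "gap m \<le> 2 * (norm \<omega>)\<^sup>2 * R\<^sup>2" "\<delta> * norm m \<le> 2 * norm \<omega> * R\<^sup>2"
      using source_gap_rate[OF \<nu> \<delta>(1)] unfolding R_def by blast
    have "gap (landweber_dual A C \<gamma> yd n) \<le> K * (gap m + \<delta> * norm m)"
      by (rule K(2)[OF \<delta> n])
    also have "\<dots> \<le> K * (2 * (norm \<omega>)\<^sup>2 * R\<^sup>2 + 2 * norm \<omega> * R\<^sup>2)"
      using m \<open>0 < K\<close> by (intro mult_left_mono add_mono) auto
    also have "\<dots> = K' * R\<^sup>2"
      by (simp add: K'_def algebra_simps)
    finally show ?thesis
      unfolding landweber_iter_eq_primal R_def[symmetric]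
      by (rule error_le_if_gap_le) (simp add: R_def)
  qed
  then show thesis
    by (rule that)
qed

end

theorem corollary4p1:
  fixes A :: "'a::{real_inner, complete_space} \<Rightarrow> 'b::{real_inner, complete_space}"
    and C :: "'a set" and y :: 'b and \<gamma> \<tau> :: real
  assumes "bounded_linear A"
    and "closed C" and "convex C"
    and "\<exists>x\<in>C. A x = y"
  shows
    "(0 < \<gamma> \<and> \<gamma> * (onorm A)\<^sup>2 \<le> 1 \<longrightarrow>
        (\<forall>(yd :: real \<Rightarrow> 'b) (n :: real \<Rightarrow> nat).
           (\<forall>\<delta>>0. norm (yd \<delta> - y) \<le> \<delta>) \<longrightarrow>
           filterlim n at_top (at_right 0) \<longrightarrow>
           ((\<lambda>\<delta>. \<delta>\<^sup>2 * real (n \<delta>)) \<longlongrightarrow> 0) (at_right 0) \<longrightarrow>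
           ((\<lambda>\<delta>. norm (landweber_iter A C \<gamma> (yd \<delta>) (n \<delta>) - min_norm_solution A C y)) \<longlongrightarrow> 0)
             (at_right 0)) \<and>
        (\<forall>\<nu> \<omega>. 0 < \<nu> \<longrightarrow> \<nu> \<le> 1 \<longrightarrow> projected_source A C \<nu> \<omega> (min_norm_solution A C y) \<longrightarrow>
           (\<forall>c1>0. \<forall>c2>0. \<exists>K. \<exists>\<delta>0>0. \<forall>\<delta> (yd :: 'b) (n :: nat).
              0 < \<delta> \<longrightarrow> \<delta> < \<delta>0 \<longrightarrow> norm (yd - y) \<le> \<delta> \<longrightarrow>
              c1 * \<delta> powr (- (2 / (1 + \<nu>))) \<le> real n \<longrightarrow>
              real n \<le> c2 * \<delta> powr (- (2 / (1 + \<nu>))) \<longrightarrow>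
              norm (landweber_iter A C \<gamma> yd n - min_norm_solution A C y)
                \<le> K * \<delta> powr (\<nu> / (1 + \<nu>)))))
     \<and>
     (\<tau> > 1 \<and> \<gamma> > 0 \<and> 1 - 1 / \<tau> - (onorm A)\<^sup>2 * \<gamma> > 0 \<longrightarrow>
        (\<forall>\<delta>>0. \<forall>yd. norm (yd - y) \<le> \<delta> \<longrightarrow> (\<exists>!n. discrepancy_index A C \<gamma> \<tau> \<delta> yd n)) \<and>
        (\<forall>(yd :: real \<Rightarrow> 'b) (n :: real \<Rightarrow> nat).
           (\<forall>\<delta>>0. norm (yd \<delta> - y) \<le> \<delta>) \<longrightarrow>
           (\<forall>\<delta>>0. discrepancy_index A C \<gamma> \<tau> \<delta> (yd \<delta>) (n \<delta>)) \<longrightarrow>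
           ((\<lambda>\<delta>. norm (landweber_iter A C \<gamma> (yd \<delta>) (n \<delta>) - min_norm_solution A C y)) \<longlongrightarrow> 0)
             (at_right 0)) \<and>
        (\<forall>\<nu> \<omega>. 0 < \<nu> \<longrightarrow> \<nu> \<le> 1 \<longrightarrow> projected_source A C \<nu> \<omega> (min_norm_solution A C y) \<longrightarrow>
           (\<exists>K. \<exists>\<delta>0>0. \<forall>\<delta> (yd :: 'b) (n :: nat).
              0 < \<delta> \<longrightarrow> \<delta> < \<delta>0 \<longrightarrow> norm (yd - y) \<le> \<delta> \<longrightarrow>
              discrepancy_index A C \<gamma> \<tau> \<delta> yd n \<longrightarrow>
              norm (landweber_iter A C \<gamma> yd n - min_norm_solution A C y)
                \<le> K * \<delta> powr (\<nu> / (1 + \<nu>)))))"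
proof -
  interpret constrained_problem A C y
    using assms by (rule constrained_problem.intro)
  have apriori: "\<exists>K. \<exists>\<delta>0>0. \<forall>\<delta> yd n. 0 < \<delta> \<longrightarrow> \<delta> < \<delta>0 \<longrightarrow> norm (yd - y) \<le> \<delta> \<longrightarrow>
      c1 * \<delta> powr (- (2 / (1 + \<nu>))) \<le> real n \<longrightarrow> real n \<le> c2 * \<delta> powr (- (2 / (1 + \<nu>))) \<longrightarrow>
      norm (landweber_iter A C \<gamma> yd n - xdag) \<le> K * \<delta> powr (\<nu> / (1 + \<nu>))"
    if "0 < \<gamma>" "\<gamma> * (onorm A)\<^sup>2 \<le> 1" "0 < \<nu>" "\<nu> \<le> 1" "projected_source A C \<nu> \<omega> xdag" "0 < c1" for \<nu> \<omega> c1 c2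
    using landweber_apriori_rate[OF that, of c2] by (meson zero_less_one)
  have discrepancy: "\<exists>K. \<exists>\<delta>0>0. \<forall>\<delta> yd n. 0 < \<delta> \<longrightarrow> \<delta> < \<delta>0 \<longrightarrow> norm (yd - y) \<le> \<delta> \<longrightarrow>
      discrepancy_index A C \<gamma> \<tau> \<delta> yd n \<longrightarrow>
      norm (landweber_iter A C \<gamma> yd n - xdag) \<le> K * \<delta> powr (\<nu> / (1 + \<nu>))"
    if "0 < \<gamma>" "1 < \<tau>" "0 < 1 - 1 / \<tau> - (onorm A)\<^sup>2 * \<gamma>" "0 < \<nu>" "\<nu> \<le> 1"
      "projected_source A C \<nu> \<omega> xdag" for \<nu> \<omega>
    using landweber_discrepancy_rate[OF that] by (meson zero_less_one)
  show ?thesis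
  proof (intro conjI impI allI, goal_cases)
    case 1
    then show ?case
      by (intro landweber_apriori_tendsto) auto
  next
    case 2
    then show ?case
      by (intro apriori) auto
  next
    case 3
    then show ?case
      by (intro discrepancy_index_unique_exists) auto
  next
    case 4
    then show ?case
      by (intro landweber_discrepancy_tendsto) auto
  next
    case 5
    then show ?case
      by (intro discrepancy) auto
  qed
qed

end
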